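(* Let $A(x)\in \mathrm{gl}_n(\mathbb{C}(x))$. The time-1-operator $T_A$ of the system of linear differential equations $\frac{dy}{dx}=A(x)y$ has rational functions as entries if and only if the system $\frac{dy}{dx}=A(x)y$ is equivalent over $\mathbb{C}(x)$ to a system with a constant diagonal coefficient matrix.
   Context: Let $x_1,\dots,x_L$ be the (finite) singularities of $A(x)$. The time-1-operator is $T_A(x)=Y(x+1,x)$, where $Y(t,x)$ denotes the solution matrix of $\frac{d}{dt}Y(t,x)=A(t)Y(t,x)$ with $Y(x,x)=I$ (continued in $t$ along the segment from $x$ to $x+1$). It is holomorphic on $\mathbb{C}\setminus\bigcup_{\ell=1}^L[x_\ell-1,x_\ell+1]$. The system $y'=A(x)y$ is equivalent over $\mathbb{C}(x)$ to $z'=\tilde A(x)z$ if there exists $G\in \mathrm{GL}_n(\mathbb{C}(x))$ with $\tilde A=G'G^{-1}+GAG^{-1}$ (gauge transformation $z=Gy$). *)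

theory Defs
  imports
    "HOL-Analysis.Analysis"
    "HOL-Computational_Algebra.Polynomial_Factorial"
    "HOL-Computational_Algebra.Field_as_Ring"
begin

text \<open>The field of rational functions over the complex numbers is the fraction field of
  \<^typ>\<open>complex poly\<close>; \<^const>\<open>quot_of_fract\<close> yields the coprime numerator and denominator.\<close>

type_synonym ratfun = "complex poly fract"

definition rat_poles :: "ratfun \<Rightarrow> complex set" where
  "rat_poles r = {z. poly (snd (quot_of_fract r)) z = 0}"

text \<open>At a pole the value is the junk value 0 (division by zero), so every use below
  excludes the poles explicitly.\<close>

definition rat_eval :: "ratfun \<Rightarrow> complex \<Rightarrow> complex" where
  "rat_eval r z = poly (fst (quot_of_fract r)) z / poly (snd (quot_of_fract r)) z"

definition rat_deriv :: "ratfun \<Rightarrow> ratfun" where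
  "rat_deriv r = (let (p, q) = quot_of_fract r in
     Fract (pderiv p * q - p * pderiv q) (q ^ 2))"

lemma rat_deriv_Fract:
  assumes "q \<noteq> 0"
  shows "rat_deriv (Fract p q) = Fract (pderiv p * q - p * pderiv q) (q ^ 2)"
proof -
  obtain a b where ab: "quot_of_fract (Fract p q) = (a, b)"
    by (cases "quot_of_fract (Fract p q)")
  have b0: "b \<noteq> 0" using snd_quot_of_fract_nonzero[of "Fract p q"] ab by simp
  have "Fract a b = Fract p q" using Fract_quot_of_fract[of "Fract p q"] ab by simp
  hence e: "a * q = p * b" using assms b0 by (simp add: eq_fract)
  hence "pderiv (a * q) = pderiv (p * b)" by simp
  hence d: "a * pderiv q + q * pderiv a = p * pderiv b + b * pderiv p"
    by (simp add: pderiv_mult)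
  have "(pderiv a * b - a * pderiv b) * q^2 - (pderiv p * q - p * pderiv q) * b^2
     = q * b * ((a * pderiv q + q * pderiv a) - (p * pderiv b + b * pderiv p))
       + (p * b - a * q) * (q * pderiv b + b * pderiv q)"
    by (simp add: algebra_simps power2_eq_square)
  also have "\<dots> = 0" using e d by simp
  finally show ?thesis using assms b0 ab
    by (simp add: rat_deriv_def eq_fract)
qed

definition mat_sing :: "ratfun^'n^'n \<Rightarrow> complex set" where
  "mat_sing A = (\<Union>i j. rat_poles (A $ i $ j))"

definition mat_eval :: "ratfun^'n^'n \<Rightarrow> complex \<Rightarrow> complex^'n^'n" where
  "mat_eval A z = (\<chi> i j. rat_eval (A $ i $ j) z)"

definition mat_deriv :: "ratfun^'n^'n \<Rightarrow> ratfun^'n^'n" where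
  "mat_deriv A = (\<chi> i j. rat_deriv (A $ i $ j))"

definition solves_on :: "ratfun^'n^'n \<Rightarrow> complex set \<Rightarrow> (complex \<Rightarrow> complex^'n^'n) \<Rightarrow> bool" where
  "solves_on A U Y \<longleftrightarrow> (\<forall>t\<in>U. \<forall>i j.
     ((\<lambda>s. Y s $ i $ j) has_field_derivative (mat_eval A t ** Y t) $ i $ j) (at t))"

text \<open>Continuation along the segment from \<open>x\<close> to \<open>x + 1\<close> is expressed by a holomorphic
  solution on an open neighbourhood of the whole segment that contains no singularity of \<open>A\<close>.
  Its values on the segment do not depend on the neighbourhood.\<close>

definition continued_solution :: "ratfun^'n^'n \<Rightarrow> complex \<Rightarrow> (complex \<Rightarrow> complex^'n^'n) \<Rightarrow> bool" where
  "continued_solution A x Y \<longleftrightarrow> Y x = mat 1 \<and>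
     (\<exists>U. open U \<and> closed_segment x (x + 1) \<subseteq> U \<and> U \<inter> mat_sing A = {} \<and> solves_on A U Y)"

definition time1 :: "ratfun^'n^'n \<Rightarrow> complex \<Rightarrow> complex^'n^'n" where
  "time1 A x = (THE M. \<exists>Y. continued_solution A x Y \<and> M = Y (x + 1))"

definition time1_domain :: "ratfun^'n^'n \<Rightarrow> complex set" where
  "time1_domain A = UNIV - (\<Union>a\<in>mat_sing A. closed_segment (a - 1) (a + 1))"

definition time1_rational :: "ratfun^'n^'n \<Rightarrow> bool" where
  "time1_rational A \<longleftrightarrow> (\<exists>R :: ratfun^'n^'n. \<forall>x\<in>time1_domain A.
     x \<notin> mat_sing R \<and> time1 A x = mat_eval R x)"

definition gauge_equiv :: "ratfun^'n^'n \<Rightarrow> ratfun^'n^'n \<Rightarrow> bool" where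
  "gauge_equiv A B \<longleftrightarrow> (\<exists>G. invertible G \<and>
     B = mat_deriv G ** matrix_inv G + G ** A ** matrix_inv G)"

definition constant_diagonal :: "ratfun^'n^'n \<Rightarrow> bool" where
  "constant_diagonal B \<longleftrightarrow>
     (\<forall>i j. i \<noteq> j \<longrightarrow> B $ i $ j = 0) \<and> (\<forall>i. \<exists>c. B $ i $ i = Fract [:c:] 1)"

end

theory Submission
  imports
    Defs
    "HOL-Computational_Algebra.Fundamental_Theorem_Algebra"
    "HOL-Complex_Analysis.Cauchy_Integral_Formula"
begin

text \<open>If \<open>T = T\<^sub>A\<close> is rational, then \<open>T' = A(x + 1) T - T A\<close>, so on \<open>\<complex>(x)\<^sup>n\<close> the connection
  \<open>D w = w' - A w\<close> commutes with the semilinear operator \<open>S w = T\<^sup>-\<^sup>1 w(x + 1)\<close>. Put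
  \<open>T\<^sub>m(x) = T(x + m - 1) \<cdots> T(x)\<close> and let \<open>N\<close> consist of the \<open>w\<close> such that \<open>T\<^sub>m w\<close> is regular
  at each point for all large \<open>m\<close> (for a fundamental matrix \<open>Y\<close> this means that \<open>Y\<^sup>-\<^sup>1 w\<close> is entire).
  Then \<open>N\<close> spans \<open>\<complex>(x)\<^sup>n\<close>, is stable under \<open>x\<close>, \<open>D\<close>, \<open>S\<close> and lies in \<open>q\<^sup>-\<^sup>1 \<complex>[x]\<^sup>n\<close> for some
  polynomial \<open>q\<close>; by counting dimensions, its rank over \<open>\<complex>[D]\<close> is finite. Modulo \<open>\<complex>[D]\<close>-torsion,
  \<open>S\<close> therefore satisfies a polynomial equation over \<open>\<complex>(D)\<close>. As \<open>[D, x] = 1\<close> and \<open>[S, x] = S\<close>,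
  the operator \<open>S\<close> behaves like \<open>e\<^sup>s\<close> over \<open>\<complex>(s)\<close>, which is transcendental. Hence \<open>N\<close> is
  torsion, so by solving \<open>r' + a r = p\<close> in polynomials it is spanned by eigenvectors of \<open>D\<close>,
  and these are the columns of the required gauge transformation.

  Conversely, if \<open>G\<close> transforms \<open>A\<close> into the constant \<open>B\<close>, then \<open>T\<^sub>A(x) = G(x + 1)\<^sup>-\<^sup>1 e\<^sup>B G(x)\<close>.\<close>

section \<open>Operators satisfying the relations of differentiation, multiplication and shift\<close>

text \<open>Gaussian elimination, one equation per induction step: an unknown \<open>p\<close>
  occurring in equation \<open>j\<close> is expressed through the others and substituted, so
  equations and unknowns both decrease by one.\<close>

lemma underdetermined_homogeneous_system:
  fixes a :: "'i \<Rightarrow> 'j \<Rightarrow> 'f::field"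
  assumes "finite J" "finite I" "card J < card I"
  shows "\<exists>c. (\<exists>i\<in>I. c i \<noteq> 0) \<and> (\<forall>j\<in>J. (\<Sum>i\<in>I. c i * a i j) = 0)"
  using assms
proof (induction J arbitrary: I a rule: finite_induct)
  case empty
  then have "I \<noteq> {}" by auto
  then show ?case by (intro exI[of _ "\<lambda>_. 1"]) auto
next
  case (insert j J)
  show ?case
  proof (cases "\<forall>i\<in>I. a i j = 0")
    case True
    have "card J < card I" using insert by simp
    from insert.IH[OF insert.prems(1) this, of a] obtain c
      where "\<exists>i\<in>I. c i \<noteq> 0" "\<forall>j\<in>J. (\<Sum>i\<in>I. c i * a i j) = 0" by blast
    with True show ?thesis by (intro exI[of _ c]) auto
  next
    case False
    then obtain p where p: "p \<in> I" "a p j \<noteq> 0" by blast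
    define I' where "I' = I - {p}"
    have I: "I = insert p I'" "p \<notin> I'" "finite I'" using p insert.prems by (auto simp: I'_def)
    have "card J < card I'" using insert I by simp
    from insert.IH[OF I(3) this, of "\<lambda>i k. a i k - a i j / a p j * a p k"] obtain c
      where c: "\<exists>i\<in>I'. c i \<noteq> 0"
        "\<forall>k\<in>J. (\<Sum>i\<in>I'. c i * (a i k - a i j / a p j * a p k)) = 0" by blast
    \<comment> \<open>The value of the eliminated unknown \<open>p\<close> that equation
      \<open>j\<close> forces.\<close>
    define s where "s = - (\<Sum>i\<in>I'. c i * a i j) / a p j"
    define c' where "c' = c(p := s)"
    have sum': "(\<Sum>i\<in>I. c' i * a i k) = s * a p k + (\<Sum>i\<in>I'. c i * a i k)" for k
    proof -
      have "(\<Sum>i\<in>I'. c' i * a i k) = (\<Sum>i\<in>I'. c i * a i k)"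
        using I(2) by (intro sum.cong) (auto simp: c'_def)
      then show ?thesis using I by (simp add: c'_def)
    qed
    have "(\<Sum>i\<in>I. c' i * a i k) = 0" if "k \<in> insert j J" for k
    proof (cases "k = j")
      case True
      then show ?thesis using p by (simp add: sum' s_def)
    next
      case False
      then have "k \<in> J" using that by simp
      then have "0 = (\<Sum>i\<in>I'. c i * (a i k - a i j / a p j * a p k))" using c(2) by simp
      also have "\<dots> = (\<Sum>i\<in>I'. c i * a i k) - (\<Sum>i\<in>I'. c i * a i j / a p j * a p k)"
        by (simp add: sum_subtractf right_diff_distrib mult.assoc)
      also have "(\<Sum>i\<in>I'. c i * a i j / a p j * a p k) = - s * a p k"
        by (simp add: s_def sum_distrib_right sum_divide_distrib)
      finally show ?thesis by (simp add: sum' add.commute)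
    qed
    moreover have "\<exists>i\<in>I. c' i \<noteq> 0" using c(1) I by (auto simp: c'_def)
    ultimately show ?thesis by blast
  qed
qed

text \<open>\<open>D_X\<close> is the defining relation of the Weyl algebra. Scalars are only
  complex numbers, because \<open>D\<close> will be \<open>w' - A w\<close>, which is not linear
  over rational functions.\<close>

locale weyl_action = vector_space scl
  for scl :: "complex \<Rightarrow> 'v::ab_group_add \<Rightarrow> 'v" +
  fixes D X :: "'v \<Rightarrow> 'v"
  assumes D_add: "D (v + w) = D v + D w"
    and D_scl: "D (scl c v) = scl c (D v)"
    and X_add: "X (v + w) = X v + X w"
    and X_scl: "X (scl c v) = scl c (X v)"
    and D_X: "D (X v) = X (D v) + v"
begin

lemma D_zero [simp]: "D 0 = 0" using D_add[of 0 0] by simp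
lemma X_zero [simp]: "X 0 = 0" using X_add[of 0 0] by simp

text \<open>This is \<open>Q(D) v\<close>, evaluated by Horner's rule so that induction over
  \<open>pCons\<close> applies.\<close>

definition act :: "complex poly \<Rightarrow> 'v \<Rightarrow> 'v" where
  "act Q v = fold_coeffs (\<lambda>a w. scl a v + D w) Q 0"

lemma act_0 [simp]: "act 0 v = 0" by (simp add: act_def)

lemma act_pCons [simp]: "act (pCons a Q) v = scl a v + D (act Q v)"
proof -
  have "(\<lambda>a w. scl a v + D w) 0 0 = 0" by simp
  then show ?thesis
    by (cases "Q = 0 \<and> a = 0") (auto simp: act_def)
qed

lemma act_add: "act (P + Q) v = act P v + act Q v"
  by (induction P Q rule: poly_induct2) (auto simp: scale_left_distrib D_add algebra_simps)

lemma act_smult: "act (smult c P) v = scl c (act P v)"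
  by (induction P) (auto simp: scale_right_distrib D_scl)

lemma act_minus: "act (- P) v = - act P v"
  using act_smult[of "-1" P v] by simp

lemma act_diff: "act (P - Q) v = act P v - act Q v"
  using act_add[of P "- Q" v] by (simp add: act_minus)

lemma act_sum: "act (\<Sum>i\<in>I. f i) v = (\<Sum>i\<in>I. act (f i) v)"
  by (induction I rule: infinite_finite_induct) (auto simp: act_add)

lemma act_add_right: "act P (v + w) = act P v + act P w"
  by (induction P) (auto simp: scale_right_distrib D_add algebra_simps)

lemma act_zero_right [simp]: "act P 0 = 0"
  using act_add_right[of P 0 0] by simp

lemma act_scl_right: "act P (scl c v) = scl c (act P v)"
  by (induction P) (auto simp: scale_right_distrib D_scl mult.commute)

lemma act_minus_right: "act P (- v) = - act P v"
  using act_scl_right[of P "-1" v] by simp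

lemma act_diff_right: "act P (v - w) = act P v - act P w"
  using act_add_right[of P v "- w"] by (simp add: act_minus_right)

lemma act_sum_right: "act P (\<Sum>i\<in>I. f i) = (\<Sum>i\<in>I. act P (f i))"
  by (induction I rule: infinite_finite_induct) (auto simp: act_add_right)

lemma act_mult: "act (P * Q) v = act P (act Q v)"
  by (induction P) (auto simp: act_add act_smult)

lemma act_commute: "act P (act Q v) = act Q (act P v)"
  using act_mult[of P Q v] act_mult[of Q P v] by (simp add: mult.commute)

lemma act_monom: "act (monom c k) v = scl c ((D ^^ k) v)"
  by (induction k) (auto simp: monom_0 monom_Suc D_scl)

text \<open>Since \<open>[D, X] = 1\<close>, the commutator with \<open>X\<close> is a derivation on
  polynomials in \<open>D\<close> sending \<open>D\<close> to 1, hence formal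
  differentiation.\<close>

lemma act_X: "act P (X v) = X (act P v) + act (pderiv P) v"
  by (induction P)
    (auto simp: pderiv_pCons act_add D_add D_X X_add X_scl algebra_simps)

section \<open>Torsion over the polynomials in \<open>D\<close>\<close>

definition torsion :: "'v set" where
  "torsion = {v. \<exists>Q. Q \<noteq> 0 \<and> act Q v = 0}"

lemma torsion_diff:
  assumes "v \<in> torsion" "w \<in> torsion" shows "v - w \<in> torsion"
proof -
  obtain P Q where "P \<noteq> 0" "act P v = 0" "Q \<noteq> 0" "act Q w = 0"
    using assms by (auto simp: torsion_def)
  moreover have "act (P * Q) (v - w) = act Q (act P v) - act P (act Q w)"
    by (simp add: act_diff_right act_mult act_commute)
  ultimately show ?thesis unfolding torsion_def
    by (intro CollectI exI[of _ "P * Q"]) auto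
qed

lemma torsion_act: "v \<in> torsion \<Longrightarrow> act P v \<in> torsion"
  unfolding torsion_def by (auto simp: act_commute[of _ P])

text \<open>Squaring the annihilator \<open>Q\<close> suffices: the derivative \<open>2 Q Q'\<close>
  of \<open>Q^2\<close>, which appears when \<open>X\<close> is moved past \<open>Q(D)^2\<close>,
  still contains the factor \<open>Q\<close>.\<close>

lemma torsion_X:
  assumes "v \<in> torsion" shows "X v \<in> torsion"
proof -
  obtain Q where Q: "Q \<noteq> 0" "act Q v = 0" using assms by (auto simp: torsion_def)
  have "act (Q * Q) (X v) = 0"
    using Q by (simp add: act_X act_mult pderiv_mult act_add)
      (metis Q(2) act_commute act_zero_right add_0)
  then show ?thesis using Q unfolding torsion_def by (intro CollectI exI[of _ "Q * Q"]) auto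
qed

lemma torsion_if_act:
  assumes "Q \<noteq> 0" "act Q v \<in> torsion" shows "v \<in> torsion"
proof -
  obtain P where "P \<noteq> 0" "act P (act Q v) = 0" using assms by (auto simp: torsion_def)
  with assms show ?thesis unfolding torsion_def
    by (intro CollectI exI[of _ "P * Q"]) (simp add: act_mult)
qed

end

text \<open>The growth condition on \<open>D\<close> is expressed through polynomial coordinates \<open>co\<close> on the
  subspace \<open>N\<close>.\<close>

locale weyl_shift_action = weyl_action scl D X
  for scl :: "complex \<Rightarrow> 'v::ab_group_add \<Rightarrow> 'v" and D X :: "'v \<Rightarrow> 'v" +
  fixes S :: "'v \<Rightarrow> 'v" and N :: "'v set"
    and co :: "'v \<Rightarrow> 'k::finite \<Rightarrow> complex poly" and \<alpha> :: nat
  assumes S_add: "S (v + w) = S v + S w"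
    and S_scl: "S (scl c v) = scl c (S v)"
    and S_D: "S (D v) = D (S v)"
    and S_X: "S (X v) = X (S v) + S v"
    and S_inj: "S v = 0 \<Longrightarrow> v = 0"
    and N_subspace: "subspace N"
    and N_D: "v \<in> N \<Longrightarrow> D v \<in> N"
    and N_X: "v \<in> N \<Longrightarrow> X v \<in> N"
    and N_S: "v \<in> N \<Longrightarrow> S v \<in> N"
    and co_add: "v \<in> N \<Longrightarrow> w \<in> N \<Longrightarrow> co (v + w) i = co v i + co w i"
    and co_scl: "v \<in> N \<Longrightarrow> co (scl c v) i = smult c (co v i)"
    and co_inj: "v \<in> N \<Longrightarrow> (\<And>i. co v i = 0) \<Longrightarrow> v = 0"
    and co_D: "v \<in> N \<Longrightarrow> (\<And>i. degree (co v i) \<le> k) \<Longrightarrow> degree (co (D v) i) \<le> k + \<alpha>"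
begin

lemma S_funpow_add: "(S ^^ j) (v + w) = (S ^^ j) v + (S ^^ j) w"
  by (induction j) (auto simp: S_add)

lemma S_funpow_scl: "(S ^^ j) (scl c v) = scl c ((S ^^ j) v)"
  by (induction j) (auto simp: S_scl)

lemma S_funpow_zero [simp]: "(S ^^ j) 0 = 0"
  using S_funpow_add[of j 0 0] by simp

lemma S_funpow_inj: "(S ^^ j) v = 0 \<Longrightarrow> v = 0"
  by (induction j) (auto dest: S_inj)

lemma S_funpow_D: "(S ^^ j) (D v) = D ((S ^^ j) v)"
  by (induction j) (auto simp: S_D)

lemma S_funpow_X: "(S ^^ j) (X v) = X ((S ^^ j) v) + scl (of_nat j) ((S ^^ j) v)"
  by (induction j) (auto simp: S_add S_X S_scl scale_left_distrib algebra_simps)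

lemma S_funpow_act: "(S ^^ j) (act P v) = act P ((S ^^ j) v)"
  by (induction P) (auto simp: S_funpow_add S_funpow_scl S_funpow_D)

lemma N_funpow_S: "v \<in> N \<Longrightarrow> (S ^^ j) v \<in> N" by (induction j) (auto intro: N_S)
lemma N_funpow_D: "v \<in> N \<Longrightarrow> (D ^^ j) v \<in> N" by (induction j) (auto intro: N_D)

lemma N_sum: "(\<And>i. i \<in> I \<Longrightarrow> f i \<in> N) \<Longrightarrow> (\<Sum>i\<in>I. f i) \<in> N"
  using N_subspace by (rule subspace_sum)

lemma N_scl: "v \<in> N \<Longrightarrow> scl c v \<in> N"
  using N_subspace by (rule subspace_scale)

lemma N_act: "v \<in> N \<Longrightarrow> act P v \<in> N"
  by (induction P)
    (auto intro: N_scl N_D subspace_add[OF N_subspace] simp: subspace_0[OF N_subspace])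

section \<open>Coordinates, dimension count and finite rank\<close>

lemma co_zero: "co 0 i = 0"
  using co_scl[of 0 0] subspace_0[OF N_subspace] by simp

lemma co_sum:
  "(\<And>j. j \<in> J \<Longrightarrow> f j \<in> N) \<Longrightarrow> co (\<Sum>j\<in>J. f j) i = (\<Sum>j\<in>J. co (f j) i)"
proof (induction J rule: infinite_finite_induct)
  case (insert x F)
  then show ?case by (simp add: co_add N_sum)
qed (auto simp: co_zero)

lemma co_funpow_D:
  "v \<in> N \<Longrightarrow> (\<And>i. degree (co v i) \<le> k) \<Longrightarrow> degree (co ((D ^^ a) v) i) \<le> k + \<alpha> * a"
proof (induction a arbitrary: i)
  case (Suc a)
  have "degree (co (D ((D ^^ a) v)) i) \<le> (k + \<alpha> * a) + \<alpha>"
    using Suc by (intro co_D N_funpow_D) auto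
  then show ?case by (simp add: algebra_simps)
qed auto

text \<open>A dimension count. Polynomials \<open>Q j\<close> of degree at most \<open>k\<close>
  have \<open>(k + 1) * card J\<close> coefficients, while coordinates of degree at most
  \<open>\<beta> + \<alpha> * k\<close> impose
  \<open>CARD('k) * (\<beta> + \<alpha> * k + 1) * card I\<close> equations. By the hypothesis on
  \<open>card J\<close>, the unknowns outnumber the equations for large \<open>k\<close>.\<close>

lemma relation_exists:
  assumes fin: "finite I" "finite J" and card: "card J > \<alpha> * CARD('k) * card I"
    and g: "\<And>j i. j \<in> J \<Longrightarrow> i \<in> I \<Longrightarrow> g j i \<in> N"
  shows "\<exists>Q. (\<exists>j\<in>J. Q j \<noteq> 0) \<and> (\<forall>i\<in>I. (\<Sum>j\<in>J. act (Q j) (g j i)) = 0)"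
proof -
  define \<beta> where "\<beta> = (\<Sum>j\<in>J. \<Sum>i\<in>I. \<Sum>c\<in>UNIV. degree (co (g j i) c))"
  have \<beta>: "degree (co (g j i) c) \<le> \<beta>" if "j \<in> J" "i \<in> I" for j i c
  proof -
    have "degree (co (g j i) c) \<le> (\<Sum>c\<in>UNIV. degree (co (g j i) c))"
      by (rule member_le_sum) auto
    also have "\<dots> \<le> (\<Sum>i\<in>I. \<Sum>c\<in>UNIV. degree (co (g j i) c))"
      using that fin by (intro member_le_sum[of i I "\<lambda>i. \<Sum>c\<in>UNIV. degree (co (g j i) c)"]) auto
    also have "\<dots> \<le> \<beta>" unfolding \<beta>_def
      using that fin by (intro member_le_sum[of j J "\<lambda>j. \<Sum>i\<in>I. \<Sum>c\<in>UNIV. degree (co (g j i) c)"]) auto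
    finally show ?thesis .
  qed
  define n where "n = CARD('k)"
  \<comment> \<open>This \<open>k\<close> absorbs the part of \<open>card E\<close> free of
    \<open>\<alpha>\<close>, so that \<open>card E\<close> becomes
    \<open>(\<alpha> * n * card I + 1) * k\<close>.\<close>
  define k where "k = n * (\<beta> + 1) * card I"
  \<comment> \<open>Unknown \<open>(a, j)\<close> is the coefficient of \<open>D^a\<close> in
    \<open>Q j\<close>; equation \<open>(r, d, i)\<close> says that the degree \<open>d\<close>
    coefficient of coordinate \<open>r\<close> vanishes in relation \<open>i\<close>.\<close>
  define U where "U = {..k} \<times> J"
  define E where "E = (UNIV :: 'k set) \<times> {..\<beta> + \<alpha> * k} \<times> I"
  have "card E = \<alpha> * n * card I * k + k"
    by (simp add: E_def k_def n_def card_cartesian_product algebra_simps)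
  also have "\<dots> < (k + 1) * (\<alpha> * n * card I + 1)" by (simp add: algebra_simps)
  also have "\<dots> \<le> (k + 1) * card J" using card by (intro mult_le_mono2) (simp add: n_def)
  also have "\<dots> = card U" by (simp add: U_def card_cartesian_product)
  finally have "card E < card U" .
  moreover have "finite E" "finite U" using fin by (auto simp: E_def U_def)
  ultimately obtain c where c: "\<exists>u\<in>U. c u \<noteq> 0"
    "\<forall>e\<in>E. (\<Sum>u\<in>U. c u * (\<lambda>(a, j) (r, d, i). coeff (co ((D ^^ a) (g j i)) r) d) u e) = 0"
    using underdetermined_homogeneous_system[of E U
        "\<lambda>(a, j) (r, d, i). coeff (co ((D ^^ a) (g j i)) r) d"] by blast
  define Q where "Q j = (\<Sum>a\<le>k. monom (c (a, j)) a)" for j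
  have cQ: "coeff (Q j) a = c (a, j)" if "a \<le> k" for a j
    using that by (simp add: Q_def coeff_sum)
  have "\<exists>j\<in>J. Q j \<noteq> 0"
  proof -
    obtain a j where "a \<le> k" "j \<in> J" "c (a, j) \<noteq> 0" using c(1) by (auto simp: U_def)
    then show ?thesis using cQ[of a j] by (intro bexI[of _ j]) auto
  qed
  moreover have "(\<Sum>j\<in>J. act (Q j) (g j i)) = 0" if i: "i \<in> I" for i
  proof (rule co_inj)
    show "(\<Sum>j\<in>J. act (Q j) (g j i)) \<in> N" using g i by (intro N_sum N_act)
    fix r
    have eq: "(\<Sum>j\<in>J. act (Q j) (g j i)) = (\<Sum>(a, j)\<in>U. scl (c (a, j)) ((D ^^ a) (g j i)))"
      unfolding U_def sum.cartesian_product[symmetric]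
      by (subst sum.swap) (simp add: Q_def act_sum act_monom)
    have "co (\<Sum>(a, j)\<in>U. scl (c (a, j)) ((D ^^ a) (g j i))) r
       = (\<Sum>u\<in>U. co (case u of (a, j) \<Rightarrow> scl (c (a, j)) ((D ^^ a) (g j i))) r)"
      using g i by (intro co_sum) (auto simp: U_def intro!: N_scl N_funpow_D)
    also have "\<dots> = (\<Sum>(a, j)\<in>U. smult (c (a, j)) (co ((D ^^ a) (g j i)) r))"
      using g i by (intro sum.cong) (auto simp: U_def co_scl N_funpow_D)
    finally have co: "co (\<Sum>j\<in>J. act (Q j) (g j i)) r
        = (\<Sum>(a, j)\<in>U. smult (c (a, j)) (co ((D ^^ a) (g j i)) r))"
      using eq by simp
    show "co (\<Sum>j\<in>J. act (Q j) (g j i)) r = 0"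
    proof (rule poly_eqI)
      fix d
      show "coeff (co (\<Sum>j\<in>J. act (Q j) (g j i)) r) d = coeff 0 d"
      proof (cases "d \<le> \<beta> + \<alpha> * k")
        case True
        then have "(r, d, i) \<in> E" using i by (simp add: E_def)
        from c(2)[rule_format, OF this] show ?thesis
          by (simp add: co coeff_sum case_prod_unfold)
      next
        case False
        \<comment> \<open>Degrees beyond the range of \<open>E\<close> do not occur, by the growth
          condition on \<open>D\<close>.\<close>
        have "degree (co ((D ^^ a) (g j i)) r) < d" if "a \<le> k" "j \<in> J" for a j
        proof -
          have "degree (co ((D ^^ a) (g j i)) r) \<le> \<beta> + \<alpha> * a"
            using that i g \<beta> by (intro co_funpow_D) auto
          also have "\<dots> \<le> \<beta> + \<alpha> * k" using that by simp
          finally show ?thesis using False by simp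
        qed
        then show ?thesis
          by (auto simp: co coeff_sum U_def coeff_eq_0 intro!: sum.neutral)
      qed
    qed
  qed
  ultimately show ?thesis by blast
qed

definition independent_family :: "nat \<Rightarrow> (nat \<Rightarrow> 'v) \<Rightarrow> bool" where
  "independent_family r e \<longleftrightarrow> (\<forall>i<r. e i \<in> N) \<and>
     (\<forall>Q. (\<Sum>i<r. act (Q i) (e i)) = 0 \<longrightarrow> (\<forall>i<r. Q i = 0))"

text \<open>The dimension count with a one-element \<open>I\<close>; it makes the rank of
  \<open>N\<close> over \<open>C[D]\<close> finite.\<close>

lemma independent_family_bound:
  assumes "independent_family r e" shows "r \<le> \<alpha> * CARD('k)"
proof (rule ccontr)
  assume "\<not> ?thesis"
  then have "card {..<r} > \<alpha> * CARD('k) * card {()}" by simp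
  from relation_exists[OF _ _ this, of "\<lambda>j _. e j"] assms
  show False by (auto simp: independent_family_def)
qed

text \<open>For a maximal independent family \<open>e\<close>, the dimension count yields an
  operator \<open>L\<close>, the sum of the \<open>Q_j(D) S^j\<close>, killing every
  \<open>e i\<close>. By maximality each \<open>f\<close> in \<open>N\<close> has a nonzero
  \<open>P\<close> with \<open>P(D) f\<close> in the \<open>C[D]\<close>-span of \<open>e\<close>.
  As \<open>L\<close> commutes with \<open>D\<close>, \<open>P(D)\<close> kills
  \<open>L f\<close>.\<close>

lemma annihilator_exists:
  "\<exists>J Q. finite J \<and> J \<noteq> {} \<and> (\<forall>j\<in>J. Q j \<noteq> 0) \<and>
     (\<forall>f\<in>N. (\<Sum>j\<in>J. act (Q j) ((S ^^ j) f)) \<in> torsion)"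
proof -
  have "independent_family 0 e" for e by (simp add: independent_family_def)
  then have ex: "\<exists>r e. independent_family r e" by blast
  have bd: "\<forall>r. (\<exists>e. independent_family r e) \<longrightarrow> r \<le> \<alpha> * CARD('k)"
    using independent_family_bound by blast
  define r where "r = (GREATEST r. \<exists>e. independent_family r e)"
  have r: "\<exists>e. independent_family r e" "\<And>r'. \<exists>e. independent_family r' e \<Longrightarrow> r' \<le> r"
    unfolding r_def by (rule GreatestI_ex_nat[OF ex bd[rule_format]], assumption)
      (rule Greatest_le_nat[OF _ bd[rule_format]], assumption+)
  from r(1) obtain e where e: "independent_family r e" by blast
  \<comment> \<open>Killing \<open>r\<close> elements takes more than
    \<open>\<alpha> * CARD('k) * r\<close> powers of \<open>S\<close>; the range
    \<open>{..m}\<close> has \<open>m + 1\<close> of them.\<close>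
  define m where "m = \<alpha> * CARD('k) * r"
  have "\<exists>Q. (\<exists>j\<in>{..m}. Q j \<noteq> 0) \<and>
      (\<forall>i\<in>{..<r}. (\<Sum>j\<in>{..m}. act (Q j) ((S ^^ j) (e i))) = 0)"
    using e by (intro relation_exists[where g = "\<lambda>j i. (S ^^ j) (e i)"])
      (auto simp: m_def independent_family_def intro!: N_funpow_S)
  then obtain Q where Q: "\<exists>j\<le>m. Q j \<noteq> 0"
    "\<And>i. i < r \<Longrightarrow> (\<Sum>j\<le>m. act (Q j) ((S ^^ j) (e i))) = 0" by auto
  define L where "L f = (\<Sum>j\<le>m. act (Q j) ((S ^^ j) f))" for f
  have L_add: "L (f + g) = L f + L g" for f g
    by (simp add: L_def S_funpow_add act_add_right sum.distrib)
  have L_0: "L 0 = 0" by (simp add: L_def)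
  have L_act: "L (act P f) = act P (L f)" for P f
    unfolding L_def act_sum_right S_funpow_act by (intro sum.cong refl act_commute)
  have L_sum: "L (\<Sum>i<k. h i) = (\<Sum>i<k. L (h i))" for h and k :: nat
    by (induction k) (auto simp: L_add L_0)
  have tors: "L f \<in> torsion" if "f \<in> N" for f
  proof -
    have "\<not> independent_family (Suc r) (e(r := f))" using r(2)[of "Suc r"] by auto
    moreover have "\<forall>i<Suc r. (e(r := f)) i \<in> N"
      using e that by (auto simp: independent_family_def less_Suc_eq)
    ultimately obtain P where P: "(\<Sum>i<Suc r. act (P i) ((e(r := f)) i)) = 0"
      "\<exists>i<Suc r. P i \<noteq> 0" unfolding independent_family_def by blast
    have P1: "(\<Sum>i<r. act (P i) (e i)) + act (P r) f = 0" using P(1) by simp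
    \<comment> \<open>Otherwise the relation would involve only the independent
      \<open>e i\<close>.\<close>
    have "P r \<noteq> 0"
    proof
      assume "P r = 0"
      then have "\<forall>i<r. P i = 0" using P1 e by (auto simp: independent_family_def)
      then show False using P(2) \<open>P r = 0\<close> by (auto simp: less_Suc_eq)
    qed
    moreover have "act (P r) (L f) = 0"
    proof -
      have "0 = L ((\<Sum>i<r. act (P i) (e i)) + act (P r) f)" using P1 L_0 by simp
      also have "\<dots> = (\<Sum>i<r. act (P i) (L (e i))) + act (P r) (L f)"
        by (simp add: L_add L_sum L_act)
      also have "(\<Sum>i<r. act (P i) (L (e i))) = 0"
        using Q(2) by (intro sum.neutral) (auto simp: L_def)
      finally show ?thesis by simp
    qed
    ultimately show ?thesis unfolding torsion_def by blast
  qed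
  define J where "J = {j. j \<le> m \<and> Q j \<noteq> 0}"
  have "L f = (\<Sum>j\<in>J. act (Q j) ((S ^^ j) f))" for f
    unfolding L_def J_def by (rule sum.mono_neutral_right) auto
  then show ?thesis using tors Q(1)
    by (intro exI[of _ J] exI[of _ Q]) (auto simp: J_def)
qed

text \<open>Commutation with \<open>X\<close> shrinks the support of a relation \<open>\<Sum>\<^sub>j Q\<^sub>j(D) S\<^sup>j = 0\<close> modulo torsion,
  because \<open>e\<^sup>s\<close> is not a rational function of \<open>s\<close>; a relation of minimal support has one term.\<close>

theorem N_torsion:
  assumes "v \<in> N" shows "v \<in> torsion"
proof -
  define good where "good c \<longleftrightarrow> (\<exists>J Q. finite J \<and> card J = c \<and> J \<noteq> {} \<and> (\<forall>j\<in>J. Q j \<noteq> 0) \<and>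
     (\<forall>f\<in>N. (\<Sum>j\<in>J. act (Q j) ((S ^^ j) f)) \<in> torsion))" for c
  have "\<exists>c. good c" using annihilator_exists unfolding good_def by blast
  then obtain c where c: "good c" "\<And>c'. good c' \<Longrightarrow> c \<le> c'"
    by (metis LeastI Least_le)
  then obtain J Q where J: "finite J" "card J = c" "J \<noteq> {}" and Q0: "\<forall>j\<in>J. Q j \<noteq> 0"
    and tors: "\<And>f. f \<in> N \<Longrightarrow> (\<Sum>j\<in>J. act (Q j) ((S ^^ j) f)) \<in> torsion"
    unfolding good_def by blast
  obtain m where m: "m \<in> J" using J by blast
  \<comment> \<open>Moving \<open>X\<close> past \<open>Q_j(D) S^j\<close> leaves
    \<open>d_j(D) S^j\<close>: the derivative comes from \<open>Q_j(D)\<close>, the multiple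
    \<open>j\<close> from \<open>S^j X = (X + j) S^j\<close>.\<close>
  define d where "d j = pderiv (Q j) + smult (of_nat j) (Q j)" for j
  \<comment> \<open>Cross-multiplication cancels the term of index \<open>m\<close>.\<close>
  define R where "R j = Q m * d j - d m * Q j" for j
  \<comment> \<open>\<open>R j = 0\<close> would make \<open>Q j / Q m\<close> a nonzero rational
    solution of \<open>f' = (m - j) f\<close>. The coefficient in degree
    \<open>degree (Q m) + degree (Q j)\<close> excludes this, since differentiation lowers
    degrees.\<close>
  have Rne: "R j \<noteq> 0" if "j \<in> J" "j \<noteq> m" for j
  proof
    assume "R j = 0"
    then have eq: "Q m * pderiv (Q j) - pderiv (Q m) * Q j
        = smult (of_nat m - of_nat j) (Q m * Q j)"
      by (simp add: R_def d_def algebra_simps smult_diff_left)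
    have ne: "Q m \<noteq> 0" "Q j \<noteq> 0" using Q0 m that by auto
    define n where "n = degree (Q m) + degree (Q j)"
    have "coeff (Q m * pderiv (Q j) - pderiv (Q m) * Q j) n = 0"
    proof (cases "n = 0")
      case True
      then have "degree (Q m) = 0" "degree (Q j) = 0" by (auto simp: n_def)
      then show ?thesis by (simp add: pderiv_eq_0_iff[THEN iffD2])
    next
      case False
      have "degree (Q m * pderiv (Q j)) < n \<or> Q m * pderiv (Q j) = 0"
        using degree_mult_le[of "Q m" "pderiv (Q j)"] False
        by (cases "degree (Q j) = 0") (auto simp: degree_pderiv n_def pderiv_eq_0_iff)
      moreover have "degree (pderiv (Q m) * Q j) < n \<or> pderiv (Q m) * Q j = 0"
        using degree_mult_le[of "pderiv (Q m)" "Q j"] False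
        by (cases "degree (Q m) = 0") (auto simp: degree_pderiv n_def pderiv_eq_0_iff)
      ultimately show ?thesis by (auto simp: coeff_eq_0)
    qed
    moreover have "coeff (Q m * Q j) n \<noteq> 0"
      using ne by (simp add: n_def coeff_mult_degree_sum)
    ultimately show False using eq \<open>j \<noteq> m\<close> by simp
  qed
  have "J = {m}"
  proof (rule ccontr)
    assume "J \<noteq> {m}"
    then obtain j where j: "j \<in> J" "j \<noteq> m" using m by blast
    define J' where "J' = J - {m}"
    have "(\<Sum>j\<in>J'. act (R j) ((S ^^ j) f)) \<in> torsion" if f: "f \<in> N" for f
    proof -
      define L where "L f = (\<Sum>j\<in>J. act (Q j) ((S ^^ j) f))" for f
      define L' where "L' = (\<Sum>j\<in>J. act (d j) ((S ^^ j) f))"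
      have "L (X f) = X (L f) + L'"
      proof -
        have "act (Q j) ((S ^^ j) (X f)) =
            X (act (Q j) ((S ^^ j) f)) + act (d j) ((S ^^ j) f)" for j
          by (simp add: S_funpow_X act_add_right act_X d_def act_add act_scl_right act_smult)
        moreover have "X (\<Sum>j\<in>I. h j) = (\<Sum>j\<in>I. X (h j))" if "finite I" for h and I :: "nat set"
          using that by induction (auto simp: X_add)
        ultimately show ?thesis using J(1) by (simp add: L_def L'_def sum.distrib)
      qed
      then have "L' = L (X f) - X (L f)" by simp
      then have "L' \<in> torsion" using tors f by (auto intro!: torsion_diff torsion_X N_X simp: L_def)
      moreover have "L f \<in> torsion" using tors f by (simp add: L_def)
      ultimately have "act (Q m) L' - act (d m) (L f) \<in> torsion"
        by (intro torsion_diff torsion_act)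
      also have "act (Q m) L' - act (d m) (L f) = (\<Sum>j\<in>J. act (R j) ((S ^^ j) f))"
        by (simp add: L'_def L_def act_sum_right R_def act_diff act_mult sum_subtractf)
      also have "\<dots> = (\<Sum>j\<in>J'. act (R j) ((S ^^ j) f))"
        unfolding J'_def using J(1) by (intro sum.mono_neutral_right) (auto simp: R_def)
      finally show ?thesis .
    qed
    then have "good (card J')"
      unfolding good_def using J(1) j Rne by (intro exI[of _ J'] exI[of _ R]) (auto simp: J'_def)
    moreover have "card J' < c"
      unfolding J'_def J(2)[symmetric] using J(1) m by (rule card_Diff1_less)
    ultimately show False using c(2) by fastforce
  qed
  \<comment> \<open>A single term remains; \<open>S^m\<close> is injective and commutes with
    \<open>D\<close>, so it can be cancelled.\<close>
  then have "(S ^^ m) (act (Q m) v) \<in> torsion"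
    using tors[OF assms] by (simp add: S_funpow_act)
  then obtain P where "P \<noteq> 0" "(S ^^ m) (act P (act (Q m) v)) = 0"
    unfolding torsion_def by (auto simp: S_funpow_act)
  then have "P \<noteq> 0" "act P (act (Q m) v) = 0" using S_funpow_inj by auto
  then have "act (Q m) v \<in> torsion" unfolding torsion_def by blast
  then show ?thesis using torsion_if_act Q0 m by blast
qed

end

section \<open>Rational functions\<close>

lemma ratfun_cases [case_names Fract]:
  fixes r :: ratfun
  assumes "\<And>p q. r = Fract p q \<Longrightarrow> q \<noteq> 0 \<Longrightarrow> P"
  shows P
  using assms by (cases r) auto

definition regular_at :: "complex \<Rightarrow> ratfun \<Rightarrow> bool" where
  "regular_at x r \<longleftrightarrow> x \<notin> rat_poles r"

text \<open>The reduced denominator divides any other denominator \<open>q\<close>, so nonvanishing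
  of \<open>q\<close> at \<open>x\<close> passes on to it.\<close>

lemma
  assumes "poly q x \<noteq> 0"
  shows regular_at_Fract: "regular_at x (Fract p q)"
    and rat_eval_Fract: "rat_eval (Fract p q) x = poly p x / poly q x"
proof -
  obtain a b where ab: "quot_of_fract (Fract p q) = (a, b)"
    by (cases "quot_of_fract (Fract p q)")
  have q0: "q \<noteq> 0" using assms by auto
  have b0: "b \<noteq> 0" using snd_quot_of_fract_nonzero[of "Fract p q"] ab by simp
  have "Fract a b = Fract p q" using Fract_quot_of_fract[of "Fract p q"] ab by simp
  then have e: "a * q = p * b" using q0 b0 by (simp add: eq_fract)
  have "coprime a b" using coprime_quot_of_fract[of "Fract p q"] ab by simp
  then have "b dvd q" using e by (metis coprime_commute coprime_dvd_mult_right_iff dvd_triv_right)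
  then have b: "poly b x \<noteq> 0" using assms by (auto simp: dvd_def)
  then show "regular_at x (Fract p q)" by (simp add: regular_at_def rat_poles_def ab)
  have "poly a x * poly q x = poly p x * poly b x" using e by (metis poly_mult)
  then show "rat_eval (Fract p q) x = poly p x / poly q x"
    using b assms by (simp add: rat_eval_def ab divide_simps)
qed

lemma regular_at_cases:
  assumes "regular_at x r"
  obtains p q where "r = Fract p q" "poly q x \<noteq> 0" "q \<noteq> 0"
proof (rule that)
  show "r = Fract (fst (quot_of_fract r)) (snd (quot_of_fract r))"
    by (rule Fract_quot_of_fract[symmetric])
qed (use assms in \<open>auto simp: regular_at_def rat_poles_def\<close>)

lemma to_fract_Fract: "to_fract p = Fract p 1"
  by (simp add: to_fract_def)

lemma to_fract_const_1 [simp]: "to_fract [:1:] = (1 :: ratfun)"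
  by (metis to_fract_1 one_pCons)

lemma
  shows regular_at_to_fract [simp, intro]: "regular_at x (to_fract p)"
    and rat_eval_to_fract [simp]: "rat_eval (to_fract p) x = poly p x"
  using regular_at_Fract[of 1 x p] rat_eval_Fract[of 1 x p] by (auto simp: to_fract_Fract)

lemma
  shows regular_at_0 [simp, intro]: "regular_at x 0" and rat_eval_0 [simp]: "rat_eval 0 x = 0"
    and regular_at_1 [simp, intro]: "regular_at x 1" and rat_eval_1 [simp]: "rat_eval 1 x = 1"
  using regular_at_to_fract[of x 0] rat_eval_to_fract[of 0 x]
    regular_at_to_fract[of x 1] rat_eval_to_fract[of 1 x] by auto

lemma
  assumes "regular_at x r" "regular_at x s"
  shows regular_at_add [intro]: "regular_at x (r + s)"
    and rat_eval_add: "rat_eval (r + s) x = rat_eval r x + rat_eval s x"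
    and regular_at_mult [intro]: "regular_at x (r * s)"
    and rat_eval_mult: "rat_eval (r * s) x = rat_eval r x * rat_eval s x"
proof -
  obtain p q p' q' where *: "r = Fract p q" "poly q x \<noteq> 0" "q \<noteq> 0"
      "s = Fract p' q'" "poly q' x \<noteq> 0" "q' \<noteq> 0"
    using assms by (metis regular_at_cases)
  have nz: "poly (q * q') x \<noteq> 0" using * by simp
  have sums: "r + s = Fract (p * q' + p' * q) (q * q')" "r * s = Fract (p * p') (q * q')"
    using * by simp_all
  have ev: "rat_eval r x = poly p x / poly q x" "rat_eval s x = poly p' x / poly q' x"
    using * by (simp_all only: rat_eval_Fract not_False_eq_True)
  show "regular_at x (r + s)" "regular_at x (r * s)"
    using sums regular_at_Fract[OF nz] by simp_all
  show "rat_eval (r + s) x = rat_eval r x + rat_eval s x"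
    unfolding sums rat_eval_Fract[OF nz] ev using * by (simp add: add_frac_eq)
  show "rat_eval (r * s) x = rat_eval r x * rat_eval s x"
    unfolding sums rat_eval_Fract[OF nz] ev by simp
qed

lemma
  assumes "regular_at x r"
  shows regular_at_minus [intro]: "regular_at x (- r)"
    and rat_eval_minus: "rat_eval (- r) x = - rat_eval r x"
proof -
  have *: "- r = to_fract [:-1:] * r"
    by (cases r rule: ratfun_cases) (simp add: to_fract_Fract)
  show "regular_at x (- r)" "rat_eval (- r) x = - rat_eval r x"
    unfolding * using assms by (auto simp: rat_eval_mult)
qed

lemma
  assumes "regular_at x r" "regular_at x s"
  shows regular_at_diff [intro]: "regular_at x (r - s)"
    and rat_eval_diff: "rat_eval (r - s) x = rat_eval r x - rat_eval s x"
  using rat_eval_add[of x r "- s"] regular_at_add[of x r "- s"] assms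
  by (auto simp: rat_eval_minus)

lemma regular_at_sum [intro]: "(\<And>i. i \<in> I \<Longrightarrow> regular_at x (f i)) \<Longrightarrow> regular_at x (\<Sum>i\<in>I. f i)"
  by (induction I rule: infinite_finite_induct) auto

lemma rat_eval_sum:
  "(\<And>i. i \<in> I \<Longrightarrow> regular_at x (f i)) \<Longrightarrow> rat_eval (\<Sum>i\<in>I. f i) x = (\<Sum>i\<in>I. rat_eval (f i) x)"
  by (induction I rule: infinite_finite_induct) (auto simp: rat_eval_add regular_at_sum)

lemma regular_at_prod [intro]: "(\<And>i. i \<in> I \<Longrightarrow> regular_at x (f i)) \<Longrightarrow> regular_at x (\<Prod>i\<in>I. f i)"
  by (induction I rule: infinite_finite_induct) auto

lemma rat_eval_prod:
  "(\<And>i. i \<in> I \<Longrightarrow> regular_at x (f i)) \<Longrightarrow> rat_eval (\<Prod>i\<in>I. f i) x = (\<Prod>i\<in>I. rat_eval (f i) x)"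
  by (induction I rule: infinite_finite_induct) (auto simp: rat_eval_mult regular_at_prod)

lemma finite_rat_poles: "finite (rat_poles r)"
  unfolding rat_poles_def by (rule poly_roots_finite) simp

text \<open>The numerator of the difference has infinitely many roots.\<close>

lemma ratfun_eqI_infinite:
  assumes "infinite S" "\<And>x. x \<in> S \<Longrightarrow> regular_at x r \<and> regular_at x s \<and> rat_eval r x = rat_eval s x"
  shows "r = s"
proof -
  define t where "t = r - s"
  have "poly (fst (quot_of_fract t)) x = 0" if "x \<in> S" for x
  proof -
    have "regular_at x t" "rat_eval t x = 0"
      using assms(2)[OF that] by (auto simp: t_def rat_eval_diff)
    then show ?thesis by (simp add: rat_eval_def regular_at_def rat_poles_def)
  qed
  then have "S \<subseteq> {x. poly (fst (quot_of_fract t)) x = 0}" by blast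
  then have "fst (quot_of_fract t) = 0"
    using assms(1) poly_roots_finite finite_subset by blast
  then have "t = 0" using Fract_quot_of_fract[of t] by (simp add: fract_collapse)
  then show ?thesis by (simp add: t_def)
qed

text \<open>The reduced denominator has no root, so it is constant by the fundamental theorem of
  algebra.\<close>

lemma polynomial_if_regular:
  assumes "\<And>x. regular_at x r" shows "r \<in> range to_fract"
proof -
  define b where "b = snd (quot_of_fract r)"
  have "\<not> (\<exists>z. poly b z = 0)" using assms by (auto simp: regular_at_def rat_poles_def b_def)
  then obtain c where b: "b = [:c:]" "c \<noteq> 0"
    using fundamental_theorem_of_algebra_alt[of b] by (metis poly_0 pCons_0_0)
  have "r = Fract (fst (quot_of_fract r)) b" by (simp add: b_def Fract_quot_of_fract)
  also have "\<dots> = to_fract (smult (1 / c) (fst (quot_of_fract r)))"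
    using b by (simp add: to_fract_Fract eq_fract)
  finally show ?thesis by blast
qed

section \<open>The derivation on rational functions\<close>

lemma rat_deriv_0 [simp]: "rat_deriv 0 = 0"
  using rat_deriv_Fract[of 1 0] by (simp add: fract_collapse)

lemma rat_deriv_to_fract [simp]: "rat_deriv (to_fract p) = to_fract (pderiv p)"
  using rat_deriv_Fract[of 1 p] by (simp add: to_fract_Fract)

lemma rat_deriv_add: "rat_deriv (r + s) = rat_deriv r + rat_deriv s"
  by (cases r rule: ratfun_cases, cases s rule: ratfun_cases)
    (simp add: rat_deriv_Fract eq_fract pderiv_add pderiv_mult algebra_simps power2_eq_square)

lemma rat_deriv_mult: "rat_deriv (r * s) = rat_deriv r * s + r * rat_deriv s"
  by (cases r rule: ratfun_cases, cases s rule: ratfun_cases)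
    (simp add: rat_deriv_Fract eq_fract pderiv_mult algebra_simps power2_eq_square)

lemma rat_deriv_sum: "rat_deriv (\<Sum>i\<in>I. f i) = (\<Sum>i\<in>I. rat_deriv (f i))"
  by (induction I rule: infinite_finite_induct) (auto simp: rat_deriv_add)

lemma regular_at_deriv [intro]: "regular_at x r \<Longrightarrow> regular_at x (rat_deriv r)"
  by (erule regular_at_cases) (auto simp: rat_deriv_Fract intro!: regular_at_Fract)

lemma has_field_derivative_rat_eval:
  assumes "regular_at x r"
  shows "(rat_eval r has_field_derivative rat_eval (rat_deriv r) x) (at x)"
proof -
  obtain p q where pq: "quot_of_fract r = (p, q)" by (cases "quot_of_fract r")
  have q: "poly q x \<noteq> 0" using assms pq by (auto simp: regular_at_def rat_poles_def)
  have "rat_eval (rat_deriv r) x = (poly (pderiv p) x * poly q x - poly p x * poly (pderiv q) x) / (poly q x * poly q x)"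
    using q by (simp add: rat_deriv_def pq rat_eval_Fract power2_eq_square)
  moreover have "((\<lambda>x. poly p x / poly q x) has_field_derivative
      (poly (pderiv p) x * poly q x - poly p x * poly (pderiv q) x) / (poly q x * poly q x)) (at x)"
    using q by (intro DERIV_divide poly_DERIV)
  moreover have "rat_eval r = (\<lambda>x. poly p x / poly q x)" by (simp add: rat_eval_def fun_eq_iff pq)
  ultimately show ?thesis by simp
qed

section \<open>Translation of the argument\<close>

definition rat_shift :: "complex \<Rightarrow> ratfun \<Rightarrow> ratfun" where
  "rat_shift a r = (let (p, q) = quot_of_fract r in
     Fract (p \<circ>\<^sub>p [:a, 1:]) (q \<circ>\<^sub>p [:a, 1:]))"

lemma pcompose_shift_eq_0_iff [simp]: "p \<circ>\<^sub>p [:a, 1:] = 0 \<longleftrightarrow> p = 0" for p :: "complex poly"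
  using pcompose_eq_0[of p "[:a, 1:]"] by auto

lemma rat_shift_Fract:
  assumes "q \<noteq> 0"
  shows "rat_shift a (Fract p q) = Fract (p \<circ>\<^sub>p [:a, 1:]) (q \<circ>\<^sub>p [:a, 1:])"
proof -
  obtain c d where cd: "quot_of_fract (Fract p q) = (c, d)"
    by (cases "quot_of_fract (Fract p q)")
  have d0: "d \<noteq> 0" using snd_quot_of_fract_nonzero[of "Fract p q"] cd by simp
  have "Fract c d = Fract p q" using Fract_quot_of_fract[of "Fract p q"] cd by simp
  then have "c * q = p * d" using assms d0 by (simp add: eq_fract)
  then have "c \<circ>\<^sub>p [:a, 1:] * q \<circ>\<^sub>p [:a, 1:] = p \<circ>\<^sub>p [:a, 1:] * d \<circ>\<^sub>p [:a, 1:]"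
    by (metis pcompose_mult)
  then show ?thesis using assms d0 by (simp add: rat_shift_def cd eq_fract)
qed

lemma rat_shift_to_fract [simp]: "rat_shift a (to_fract p) = to_fract (p \<circ>\<^sub>p [:a, 1:])"
  using rat_shift_Fract[of 1 a p] by (simp add: to_fract_Fract pcompose_1)

lemma rat_shift_0 [simp]: "rat_shift a 0 = 0" using rat_shift_to_fract[of a 0] by simp
lemma rat_shift_1 [simp]: "rat_shift a 1 = 1" using rat_shift_to_fract[of a 1] by (simp add: pcompose_1)

lemma rat_shift_add: "rat_shift a (r + s) = rat_shift a r + rat_shift a s"
  by (cases r rule: ratfun_cases, cases s rule: ratfun_cases)
    (simp add: rat_shift_Fract pcompose_add pcompose_mult)

lemma rat_shift_mult: "rat_shift a (r * s) = rat_shift a r * rat_shift a s"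
  by (cases r rule: ratfun_cases, cases s rule: ratfun_cases)
    (simp add: rat_shift_Fract pcompose_mult)

lemma rat_shift_minus: "rat_shift a (- r) = - rat_shift a r"
  using rat_shift_add[of a r "- r"] by (simp add: eq_neg_iff_add_eq_0 add.commute)

lemma rat_shift_diff: "rat_shift a (r - s) = rat_shift a r - rat_shift a s"
  using rat_shift_add[of a r "- s"] by (simp add: rat_shift_minus)

lemma rat_shift_sum: "rat_shift a (\<Sum>i\<in>I. f i) = (\<Sum>i\<in>I. rat_shift a (f i))"
  by (induction I rule: infinite_finite_induct) (auto simp: rat_shift_add)

lemma rat_shift_shift: "rat_shift a (rat_shift b r) = rat_shift (a + b) r"
proof (cases r rule: ratfun_cases)
  case (Fract p q)
  have "[:b, 1:] \<circ>\<^sub>p [:a, 1:] = [:a + b, 1:]" by (simp add: pcompose_pCons add.commute)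
  then show ?thesis using Fract by (simp add: rat_shift_Fract flip: pcompose_assoc)
qed

lemma rat_shift_by_0 [simp]: "rat_shift 0 r = r"
  by (cases r rule: ratfun_cases) (simp add: rat_shift_Fract)

lemma rat_shift_eq_0_iff [simp]: "rat_shift a r = 0 \<longleftrightarrow> r = 0"
  using rat_shift_shift[of "- a" a r] by auto

lemma rat_deriv_shift: "rat_deriv (rat_shift a r) = rat_shift a (rat_deriv r)"
proof (cases r rule: ratfun_cases)
  case (Fract p q)
  have "pderiv (p \<circ>\<^sub>p [:a, 1:]) = pderiv p \<circ>\<^sub>p [:a, 1:]" for p :: "complex poly"
    by (simp add: pderiv_pcompose pderiv_pCons)
  then show ?thesis using Fract
    by (simp add: rat_shift_Fract rat_deriv_Fract pcompose_diff pcompose_mult power2_eq_square)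
qed

lemma
  assumes "regular_at (x + a) r"
  shows regular_at_shift: "regular_at x (rat_shift a r)"
    and rat_eval_shift: "rat_eval (rat_shift a r) x = rat_eval r (x + a)"
proof -
  obtain p q where "r = Fract p q" "poly q (x + a) \<noteq> 0" "q \<noteq> 0"
    using assms by (rule regular_at_cases)
  moreover have "poly (q \<circ>\<^sub>p [:a, 1:]) x = poly q (x + a)" for q :: "complex poly"
    by (simp add: poly_pcompose add.commute)
  ultimately show "regular_at x (rat_shift a r)" "rat_eval (rat_shift a r) x = rat_eval r (x + a)"
    by (auto simp: rat_shift_Fract rat_eval_Fract intro!: regular_at_Fract)
qed

section \<open>Pole orders and ordinary points\<close>

lemma regular_at_times_power:
  obtains K where "regular_at x (to_fract ([:- x, 1:] ^ K) * r)"
proof (cases r rule: ratfun_cases)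
  case (Fract p q)
  obtain q' where q: "q = [:- x, 1:] ^ order x q * q'" "\<not> [:- x, 1:] dvd q'"
    using order_decomp[OF Fract(2)] by blast
  define l where "l = [:- x, 1:] ^ order x q"
  have l: "q = l * q'" using q(1) by (simp only: l_def)
  have "to_fract l * r = Fract p q'"
    using Fract l by (simp add: to_fract_Fract eq_fract)
  moreover have "poly q' x \<noteq> 0" using q(2) by (simp add: poly_eq_0_iff_dvd)
  ultimately have "regular_at x (to_fract ([:- x, 1:] ^ order x q) * r)"
    by (simp add: regular_at_Fract flip: l_def)
  then show ?thesis by (rule that)
qed

lemma regular_at_times_power_mono:
  assumes "regular_at x (to_fract ([:- x, 1:] ^ K) * r)" "K \<le> K'"
  shows "regular_at x (to_fract ([:- x, 1:] ^ K') * r)"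
proof -
  have "to_fract ([:- x, 1:] ^ K') * r
      = to_fract ([:- x, 1:] ^ (K' - K)) * (to_fract ([:- x, 1:] ^ K) * r)"
    using assms(2) by (simp flip: to_fract_mult power_add add: mult.assoc[symmetric])
  then show ?thesis by (simp only:) (intro regular_at_mult assms(1) regular_at_to_fract)
qed

lemma regular_at_times_power_finite:
  assumes "finite I"
  shows "\<exists>K. \<forall>i\<in>I. regular_at x (to_fract ([:- x, 1:] ^ K) * h i)"
proof -
  have "\<exists>K. regular_at x (to_fract ([:- x, 1:] ^ K) * h i)" for i
    by (rule regular_at_times_power[of x "h i"]) blast
  then obtain K where K: "\<And>i. regular_at x (to_fract ([:- x, 1:] ^ K i) * h i)" by metis
  show ?thesis
  proof (intro exI ballI)
    fix i assume "i \<in> I"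
    then have "K i \<le> (\<Sum>i\<in>I. K i)" using assms by (intro member_le_sum) auto
    with K show "regular_at x (to_fract ([:- x, 1:] ^ (\<Sum>i\<in>I. K i)) * h i)"
      by (rule regular_at_times_power_mono)
  qed
qed

text \<open>A pole of order \<open>m > 0\<close> of the solution would be a pole of order \<open>m + 1\<close> of its derivative,
  but only of order \<open>m\<close> of the right-hand side.\<close>

lemma regular_at_ordinary_point:
  fixes h :: "'i::finite \<Rightarrow> ratfun"
  assumes a: "\<And>i j. regular_at x (a i j)"
    and h: "\<And>i. rat_deriv (h i) = (\<Sum>j\<in>UNIV. a i j * h j)"
  shows "regular_at x (h i)"
proof -
  define z where "z = to_fract [:- x, 1:]"
  have dz: "rat_deriv (z ^ Suc m) = of_nat (Suc m) * z ^ m" for m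
  proof (induction m)
    case 0
    show ?case by (simp add: z_def pderiv_pCons)
  next
    case (Suc m)
    have "rat_deriv (z ^ Suc (Suc m)) = rat_deriv z * z ^ Suc m + z * rat_deriv (z ^ Suc m)"
      by (simp add: rat_deriv_mult)
    also have "rat_deriv z = 1" by (simp add: z_def pderiv_pCons)
    finally show ?case by (simp only: Suc) (simp add: algebra_simps)
  qed
  \<comment> \<open>Descent on the pole order: for \<open>g = z^(m+1) h\<close> the differential
    equation gives \<open>(m + 1) z^m h = g' - a g\<close>, and the right-hand side is
    regular.\<close>
  have step: "\<forall>i. regular_at x (z ^ m * h i)" if *: "\<forall>i. regular_at x (z ^ Suc m * h i)" for m
  proof
    fix i
    define g where "g i = z ^ Suc m * h i" for i
    have "rat_deriv (g i) = of_nat (Suc m) * z ^ m * h i + z ^ Suc m * (\<Sum>j\<in>UNIV. a i j * h j)"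
      unfolding g_def by (subst rat_deriv_mult) (simp only: dz h)
    also have "z ^ Suc m * (\<Sum>j\<in>UNIV. a i j * h j) = (\<Sum>j\<in>UNIV. a i j * g j)"
      by (simp add: g_def sum_distrib_left mult_ac)
    finally have "of_nat (Suc m) * (z ^ m * h i) = rat_deriv (g i) - (\<Sum>j\<in>UNIV. a i j * g j)"
      by (simp add: mult.assoc)
    moreover have "regular_at x (rat_deriv (g i) - (\<Sum>j\<in>UNIV. a i j * g j))"
    proof -
      have "regular_at x (g j)" for j using * by (simp add: g_def del: power_Suc)
      then show ?thesis using a by blast
    qed
    \<comment> \<open>In characteristic 0 the factor \<open>m + 1\<close> is removed by a constant,
      which is regular everywhere.\<close>
    moreover have "to_fract [:1 / of_nat (Suc m):] * (of_nat (Suc m) * r) = r" for r :: ratfun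
    proof -
      have of_nat: "(of_nat k :: ratfun) = to_fract [:of_nat k:]" for k
      proof (induction k)
        case (Suc k)
        have "(of_nat (Suc k) :: ratfun) = to_fract [:1:] + to_fract [:of_nat k:]"
          by (simp add: Suc)
        also have "\<dots> = to_fract ([:1:] + [:of_nat k:])" by (rule to_fract_add[symmetric])
        finally show ?case by simp
      qed simp
      have "to_fract [:1 / of_nat (Suc m):] * (of_nat (Suc m) :: ratfun) = 1"
        by (simp add: of_nat flip: to_fract_mult del: of_nat_Suc)
      then show ?thesis by (simp add: mult.assoc[symmetric])
    qed
    ultimately show "regular_at x (z ^ m * h i)"
      by (metis regular_at_mult regular_at_to_fract)
  qed
  have z: "z ^ K = to_fract ([:- x, 1:] ^ K)" for K
    unfolding z_def by (induction K) (simp_all only: power_0 power_Suc to_fract_1 to_fract_mult)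
  obtain K where K: "\<forall>i. regular_at x (z ^ K * h i)"
    unfolding z using regular_at_times_power_finite[of UNIV x h] by auto
  have "\<forall>i. regular_at x (z ^ 0 * h i)"
    using K by (induction K) (use step in blast)+
  then show ?thesis by simp
qed

section \<open>Linear differential equations on a disc\<close>

text \<open>The mean value inequality along the segment from \<open>x0\<close> to \<open>z\<close>:
  the point at parameter \<open>t\<close> has distance \<open>t * norm (z - x0)\<close> from
  \<open>x0\<close>, and integrating \<open>t^k\<close> yields the factor
  \<open>1 / (k + 1)\<close>.\<close>

lemma norm_bound_from_deriv_bound:
  assumes d: "\<And>z. z \<in> ball x0 R \<Longrightarrow> (h has_field_derivative g z) (at z)"
    and g: "\<And>z. z \<in> ball x0 R \<Longrightarrow> norm (g z) \<le> c * norm (z - x0) ^ k"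
    and z: "z \<in> ball x0 R"
  shows "norm (h z - h x0) \<le> c * norm (z - x0) ^ Suc k / real (Suc k)"
proof -
  define r where "r = norm (z - x0)"
  define p where "p t = x0 + of_real t * (z - x0)" for t
  have p: "p t \<in> ball x0 R" if "0 \<le> t" "t \<le> 1" for t
  proof -
    have "norm (of_real t * (z - x0)) \<le> 1 * norm (z - x0)"
      unfolding norm_mult using that by (intro mult_right_mono) auto
    also have "\<dots> < R" using z by (simp add: dist_norm norm_minus_commute)
    finally show ?thesis by (simp add: p_def dist_norm)
  qed
  have hp: "((\<lambda>t. h (p t)) has_vector_derivative (z - x0) * g (p t)) (at t)" if "0 \<le> t" "t \<le> 1" for t
  proof -
    have "(p has_vector_derivative (z - x0)) (at t)"
      unfolding p_def by (auto intro!: derivative_eq_intros)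
    from field_vector_diff_chain_at[OF this d[OF p[OF that]]] show ?thesis by (simp add: o_def)
  qed
  have cont: "continuous_on {0..1} (\<lambda>t. h (p t))"
    by (intro continuous_at_imp_continuous_on ballI has_vector_derivative_continuous[OF hp]) auto
  have "norm (h (p 1) - h (p 0)) \<le> (\<lambda>t. c * r ^ Suc k * t ^ Suc k / real (Suc k)) 1
      - (\<lambda>t. c * r ^ Suc k * t ^ Suc k / real (Suc k)) 0"
  proof (rule differentiable_bound_general[where f' = "\<lambda>t. (z - x0) * g (p t)"
        and \<phi>' = "\<lambda>t. c * r ^ Suc k * t ^ k"])
    fix t :: real assume t: "0 < t" "t < 1"
    show "((\<lambda>t. h (p t)) has_vector_derivative (z - x0) * g (p t)) (at t)" using t hp by simp
    have "((\<lambda>t. t ^ Suc k) has_field_derivative real (Suc k) * t ^ k) (at t)"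
      using DERIV_pow[of "Suc k" t] by simp
    then have "((\<lambda>t. c * r ^ Suc k / real (Suc k) * t ^ Suc k) has_field_derivative
        c * r ^ Suc k / real (Suc k) * (real (Suc k) * t ^ k)) (at t)"
      by (rule DERIV_cmult)
    then show "((\<lambda>t. c * r ^ Suc k * t ^ Suc k / real (Suc k)) has_vector_derivative
        c * r ^ Suc k * t ^ k) (at t)"
      unfolding has_real_derivative_iff_has_vector_derivative[symmetric]
      by (simp del: power_Suc of_nat_Suc add: mult.assoc)
    have "norm (g (p t)) \<le> c * norm (p t - x0) ^ k" using t p by (intro g) auto
    also have "norm (p t - x0) = t * r" using t by (simp add: p_def r_def norm_mult)
    finally have "norm (z - x0) * norm (g (p t)) \<le> r * (c * (t * r) ^ k)"
      unfolding r_def by (rule mult_left_mono) simp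
    then show "norm ((z - x0) * g (p t)) \<le> c * r ^ Suc k * t ^ k"
      by (simp only: norm_mult power_mult_distrib power_Suc mult_ac)
  qed (auto intro!: cont continuous_intros)
  then show ?thesis by (simp add: p_def r_def)
qed

text \<open>Picard iteration: the \<open>k\<close>-th correction is bounded by \<open>C (B \<bar>z - x0\<bar>)\<^sup>k / k!\<close>.\<close>

lemma linear_ode_on_ball:
  fixes a :: "'n::finite \<Rightarrow> 'n \<Rightarrow> complex \<Rightarrow> complex"
  assumes hol: "\<And>i j. a i j holomorphic_on ball x0 R"
    and bound: "\<And>i j z. z \<in> ball x0 R \<Longrightarrow> norm (a i j z) \<le> M"
    and R: "0 < R"
  shows "\<exists>f. (\<forall>i. f i x0 = y i) \<and> (\<forall>i. \<forall>z\<in>ball x0 R.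
    (f i has_field_derivative (\<Sum>j\<in>UNIV. a i j z * f j z)) (at z))"
proof -
  \<comment> \<open>Primitives are normalised to vanish at \<open>x0\<close>, so that the
    corrections leave the initial value intact.\<close>
  define is_prim where "is_prim g h \<longleftrightarrow> h x0 = 0 \<and>
     (\<forall>z\<in>ball x0 R. (h has_field_derivative g z) (at z))" for g h :: "complex \<Rightarrow> complex"
  define prim where "prim g = (SOME h. is_prim g h)" for g
  have prim: "is_prim g (prim g)" if "g holomorphic_on ball x0 R" for g
  proof -
    obtain h where h: "\<And>x. x \<in> ball x0 R \<Longrightarrow> (h has_field_derivative g x) (at x within ball x0 R)"
      using holomorphic_convex_primitive'[OF convex_ball open_ball \<open>g holomorphic_on _\<close>] by blast
    have "((\<lambda>z. h z - h x0) has_field_derivative g z) (at z)" if "z \<in> ball x0 R" for z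
      using h[OF that] that by (auto intro!: derivative_eq_intros simp: at_within_open[OF _ open_ball])
    then have "is_prim g (\<lambda>z. h z - h x0)" by (simp add: is_prim_def)
    then show ?thesis unfolding prim_def by (rule someI[of "is_prim g"])
  qed
  \<comment> \<open>\<open>u k\<close> is the \<open>k\<close>-th correction, not a partial sum; the
    solution is the series of all \<open>u k\<close>.\<close>
  define u where "u = rec_nat (\<lambda>i z. y i) (\<lambda>k v i. prim (\<lambda>z. \<Sum>j\<in>UNIV. a i j z * v j z))"
  have u0: "u 0 i z = y i" for i z by (simp add: u_def)
  have uS: "u (Suc k) i = prim (\<lambda>z. \<Sum>j\<in>UNIV. a i j z * u k j z)" for k i by (simp add: u_def)
  have uhol: "u k i holomorphic_on ball x0 R" for k i
  proof (induction k arbitrary: i)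
    case 0
    have "u 0 i = (\<lambda>_. y i)" by (simp add: u0 fun_eq_iff)
    then show ?case by simp
  next
    case (Suc k)
    have "is_prim (\<lambda>z. \<Sum>j\<in>UNIV. a i j z * u k j z) (u (Suc k) i)"
      unfolding uS by (intro prim holomorphic_intros hol Suc)
    then show ?case
      by (auto simp: is_prim_def holomorphic_on_open intro!: exI)
  qed
  have uprim: "is_prim (\<lambda>z. \<Sum>j\<in>UNIV. a i j z * u k j z) (u (Suc k) i)" for k i
    unfolding uS by (intro prim holomorphic_intros hol uhol)
  define C where "C = (\<Sum>j\<in>UNIV. norm (y j))"
  define B where "B = real CARD('n) * M"
  have M0: "0 \<le> M" using bound[of x0] R norm_ge_zero order_trans by (metis centre_in_ball)
  have ub: "norm (u k i z) \<le> C * B ^ k / fact k * norm (z - x0) ^ k" if "z \<in> ball x0 R" for k i z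
    using that
  proof (induction k arbitrary: i z)
    case 0
    then show ?case by (auto simp: u0 C_def intro: member_le_sum)
  next
    case (Suc k)
    have "norm (u (Suc k) i z - u (Suc k) i x0)
        \<le> B * (C * B ^ k / fact k) * norm (z - x0) ^ Suc k / real (Suc k)"
    proof (rule norm_bound_from_deriv_bound[of x0 R _ "\<lambda>z. \<Sum>j\<in>UNIV. a i j z * u k j z"])
      fix w assume w: "w \<in> ball x0 R"
      have "norm (\<Sum>j\<in>UNIV. a i j w * u k j w)
          \<le> (\<Sum>j\<in>(UNIV::'n set). M * (C * B ^ k / fact k * norm (w - x0) ^ k))"
        unfolding norm_mult using w M0
        by (intro order.trans[OF norm_sum] sum_mono)
          (simp add: norm_mult del: times_divide_eq_left times_divide_eq_right,
            intro mult_mono bound Suc.IH, auto)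
      also have "\<dots> = B * (C * B ^ k / fact k) * norm (w - x0) ^ k" by (simp add: B_def)
      finally show "norm (\<Sum>j\<in>UNIV. a i j w * u k j w)
          \<le> B * (C * B ^ k / fact k) * norm (w - x0) ^ k" .
    qed (use uprim[of i k] Suc.prems in \<open>auto simp: is_prim_def\<close>)
    moreover have "u (Suc k) i x0 = 0" using uprim[of i k] by (simp add: is_prim_def)
    ultimately show ?case by (simp add: field_simps)
  qed
  \<comment> \<open>A summable majorant on the whole ball: \<open>C\<close> times the exponential
    series of \<open>B * R\<close>.\<close>
  define h where "h k = C * ((B * R) ^ k /\<^sub>R fact k)" for k
  have "summable h" unfolding h_def by (intro summable_mult summable_exp_generic)
  have uh: "norm (u k i z) \<le> h k" if "z \<in> ball x0 R" for k i z
  proof -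
    have "norm (u k i z) \<le> C * B ^ k / fact k * norm (z - x0) ^ k" using that by (rule ub)
    also have "\<dots> \<le> C * B ^ k / fact k * R ^ k"
      using that M0 by (intro mult_left_mono power_mono)
        (auto simp: dist_norm norm_minus_commute C_def B_def
          intro!: sum_nonneg divide_nonneg_nonneg mult_nonneg_nonneg)
    finally show ?thesis by (simp add: h_def power_mult_distrib field_simps)
  qed
  \<comment> \<open>The termwise derivatives. Differentiating \<open>u (Suc k)\<close> returns
    \<open>a\<close> applied to \<open>u k\<close>, whence the index shift; the constant
    \<open>u 0\<close> contributes 0.\<close>
  define u' where "u' k i z = (case k of 0 \<Rightarrow> 0 | Suc k \<Rightarrow> \<Sum>j\<in>UNIV. a i j z * u k j z)" for k i z
  have du: "(u k i has_field_derivative u' k i z) (at z)" if "z \<in> ball x0 R" for k i z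
  proof (cases k)
    case 0
    have "u 0 i = (\<lambda>_. y i)" by (simp add: u0 fun_eq_iff)
    then show ?thesis by (simp add: 0 u'_def)
  next
    case (Suc k')
    then show ?thesis using uprim[of i k'] that by (simp add: is_prim_def u'_def)
  qed
  have "\<exists>g g'. \<forall>z\<in>ball x0 R. (\<lambda>k. u k i z) sums g z \<and> (\<lambda>k. u' k i z) sums g' z \<and>
      (g has_field_derivative g' z) (at z)" for i
    by (rule series_and_derivative_comparison[OF open_ball[of x0 R] \<open>summable h\<close>, of "\<lambda>k. u k i" "\<lambda>k. u' k i"])
      (use du uh in \<open>auto intro!: always_eventually\<close>)
  then obtain f f' where f: "\<And>i z. z \<in> ball x0 R \<Longrightarrow> (\<lambda>k. u k i z) sums f i z"
      "\<And>i z. z \<in> ball x0 R \<Longrightarrow> (\<lambda>k. u' k i z) sums f' i z"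
      "\<And>i z. z \<in> ball x0 R \<Longrightarrow> (f i has_field_derivative f' i z) (at z)"
    by metis
  show ?thesis
  proof (intro exI conjI allI ballI)
    fix i
    have "u k i x0 = 0" if "k \<noteq> 0" for k
      using that uprim[of i "k - 1"] by (cases k) (auto simp: is_prim_def)
    then have "(\<lambda>k. u k i x0) sums (\<Sum>k\<in>{0}. u k i x0)" by (intro sums_finite) auto
    moreover have "(\<lambda>k. u k i x0) sums f i x0" using f(1) R by simp
    ultimately show "f i x0 = y i" using sums_unique2 by (fastforce simp: u0)
  next
    fix i z assume z: "z \<in> ball x0 R"
    have "(\<lambda>k. \<Sum>j\<in>UNIV. a i j z * u k j z) sums (\<Sum>j\<in>UNIV. a i j z * f j z)"
      using f(1) z by (intro sums_sum sums_mult)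
    then have "(\<lambda>k. u' (Suc k) i z) sums (\<Sum>j\<in>UNIV. a i j z * f j z)" by (simp add: u'_def)
    then have "(\<lambda>k. u' k i z) sums (\<Sum>j\<in>UNIV. a i j z * f j z)"
      using sums_Suc[of "\<lambda>k. u' k i z"] by (simp add: u'_def)
    then have "f' i z = (\<Sum>j\<in>UNIV. a i j z * f j z)" using f(2)[OF z] sums_unique2 by blast
    then show "(f i has_field_derivative (\<Sum>j\<in>UNIV. a i j z * f j z)) (at z)"
      using f(3)[OF z, of i] by simp
  qed
qed

section \<open>Matrices of rational functions\<close>

lemma matrix_minus_mult_left: "(- A) ** B = - (A ** B)" for A :: "'a::ring_1^'n^'m"
  by (simp add: vec_eq_iff matrix_matrix_mult_def sum_negf)

lemma matrix_minus_mult_right: "A ** (- B) = - (A ** B)" for A :: "'a::ring_1^'n^'m"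
  by (simp add: vec_eq_iff matrix_matrix_mult_def sum_negf)

lemma matrix_add_rdistrib': "(A + B) ** C = A ** C + B ** C" for A :: "'a::semiring_1^'n^'m"
  by (simp add: vec_eq_iff matrix_matrix_mult_def sum.distrib distrib_right)

lemma matrix_diff_ldistrib: "A ** (B - C) = A ** B - A ** C" for A :: "'a::ring_1^'n^'m"
  by (simp add: vec_eq_iff matrix_matrix_mult_def sum_subtractf right_diff_distrib)

lemma matrix_diff_rdistrib: "(A - B) ** C = A ** C - B ** C" for A :: "'a::ring_1^'n^'m"
  by (simp add: vec_eq_iff matrix_matrix_mult_def sum_subtractf left_diff_distrib)

lemmas matrix_ring_simps = matrix_minus_mult_left matrix_minus_mult_right matrix_add_ldistrib
  matrix_add_rdistrib' matrix_diff_ldistrib matrix_diff_rdistrib matrix_mul_assoc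

lemma
  assumes "invertible A"
  shows matrix_inv_right: "A ** matrix_inv A = mat 1"
    and matrix_inv_left: "matrix_inv A ** A = mat 1"
proof -
  have "A ** matrix_inv A = mat 1 \<and> matrix_inv A ** A = mat 1"
    unfolding matrix_inv_def using assms unfolding invertible_def by (rule someI_ex)
  then show "A ** matrix_inv A = mat 1" "matrix_inv A ** A = mat 1" by auto
qed

abbreviation mat_regular_at :: "complex \<Rightarrow> ratfun^'n^'n \<Rightarrow> bool" where
  "mat_regular_at x M \<equiv> \<forall>i j. regular_at x (M $ i $ j)"

lemma mat_sing_iff: "x \<in> mat_sing M \<longleftrightarrow> \<not> mat_regular_at x M"
  by (simp add: mat_sing_def regular_at_def)

lemma finite_mat_sing: "finite (mat_sing M)"
  unfolding mat_sing_def by (intro finite_UN_I finite_rat_poles) auto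

lemma
  assumes "mat_regular_at x A" "mat_regular_at x B"
  shows mat_regular_at_mult: "mat_regular_at x (A ** B)"
    and mat_eval_mult: "mat_eval (A ** B) x = mat_eval A x ** mat_eval B x"
    and mat_regular_at_diff: "mat_regular_at x (A - B)"
    and mat_eval_diff: "mat_eval (A - B) x = mat_eval A x - mat_eval B x"
proof -
  have "regular_at x (A $ i $ k * B $ k $ j)" for i k j using assms by auto
  then show "mat_regular_at x (A ** B)" "mat_eval (A ** B) x = mat_eval A x ** mat_eval B x"
    using assms
    by (auto simp: matrix_matrix_mult_def mat_eval_def vec_eq_iff rat_eval_sum rat_eval_mult)
  show "mat_regular_at x (A - B)" "mat_eval (A - B) x = mat_eval A x - mat_eval B x"
    using assms by (auto simp: mat_eval_def vec_eq_iff rat_eval_diff)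
qed

lemma mat_eval_mat1: "mat_eval (mat 1) x = mat 1"
  by (simp add: mat_eval_def mat_def vec_eq_iff)

lemma mat_deriv_mult: "mat_deriv (A ** B) = mat_deriv A ** B + A ** mat_deriv B"
  by (simp add: mat_deriv_def matrix_matrix_mult_def vec_eq_iff rat_deriv_sum rat_deriv_mult sum.distrib)

lemma rat_deriv_1 [simp]: "rat_deriv 1 = 0"
  using rat_deriv_to_fract[of 1] by simp

lemma mat_deriv_mat1: "mat_deriv (mat 1) = 0"
  by (simp add: mat_deriv_def mat_def vec_eq_iff)

lemma mat_regular_at_deriv: "mat_regular_at x A \<Longrightarrow> mat_regular_at x (mat_deriv A)"
  by (auto simp: mat_deriv_def)

definition mat_shift :: "complex \<Rightarrow> ratfun^'n^'n \<Rightarrow> ratfun^'n^'n" where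
  "mat_shift a A = (\<chi> i j. rat_shift a (A $ i $ j))"

lemma mat_shift_mult: "mat_shift a (A ** B) = mat_shift a A ** mat_shift a B"
  by (simp add: mat_shift_def matrix_matrix_mult_def vec_eq_iff rat_shift_sum rat_shift_mult)

lemma mat_shift_diff: "mat_shift a (A - B) = mat_shift a A - mat_shift a B"
  by (simp add: mat_shift_def vec_eq_iff rat_shift_diff)

lemma mat_shift_mat1: "mat_shift a (mat 1) = mat 1"
  by (simp add: mat_shift_def mat_def vec_eq_iff)

lemma mat_shift_shift: "mat_shift a (mat_shift b A) = mat_shift (a + b) A"
  by (simp add: mat_shift_def rat_shift_shift)

lemma mat_shift_by_0 [simp]: "mat_shift 0 A = A"
  by (simp add: mat_shift_def)

lemma mat_deriv_shift: "mat_deriv (mat_shift a A) = mat_shift a (mat_deriv A)"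
  by (simp add: mat_shift_def mat_deriv_def rat_deriv_shift)

lemma
  assumes "mat_regular_at (x + a) A"
  shows mat_regular_at_shift: "mat_regular_at x (mat_shift a A)"
    and mat_eval_shift: "mat_eval (mat_shift a A) x = mat_eval A (x + a)"
  using assms by (auto simp: mat_shift_def mat_eval_def rat_eval_shift intro: regular_at_shift)

text \<open>Differentiating \<open>H G = 1\<close> gives \<open>H' = - H G' H\<close>; inserting the
  equation for \<open>G\<close> exchanges the roles of \<open>A\<close> and
  \<open>B\<close>.\<close>

lemma mat_deriv_inverse:
  assumes GH: "G ** H = mat 1" and HG: "H ** G = mat 1"
    and G: "mat_deriv G = B ** G - G ** A"
  shows "mat_deriv H = A ** H - H ** B"
proof -
  have "0 = mat_deriv (H ** G) ** H"
    unfolding HG mat_deriv_mat1 by (simp add: matrix_matrix_mult_def vec_eq_iff)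
  also have "\<dots> = mat_deriv H ** (G ** H) + H ** B ** (G ** H) - (H ** G) ** A ** H"
    unfolding mat_deriv_mult G by (simp add: matrix_ring_simps)
  also have "\<dots> = mat_deriv H + H ** B - A ** H" by (simp add: GH HG)
  finally show ?thesis by (simp add: algebra_simps)
qed

text \<open>The entries of \<open>M\<close>, listed as a vector indexed by pairs, solve a linear
  system. Its coefficients \<open>a\<close> represent the linear map sending \<open>M\<close> to
  \<open>A M - M B\<close> and are regular at \<open>x\<close>.\<close>

lemma mat_regular_at_ordinary_point:
  assumes A: "mat_regular_at x A" and B: "mat_regular_at x B"
    and M: "mat_deriv M = A ** M - M ** B"
  shows "mat_regular_at x M"
proof -
  define h where "h = (\<lambda>(i, j). M $ i $ j)"
  define a where "a = (\<lambda>(i, j) (k, l).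
     (if l = j then A $ i $ k else 0) - (if k = i then B $ l $ j else 0))"
  have "regular_at x (h p)" for p
  proof (rule regular_at_ordinary_point)
    show "regular_at x (a p q)" for p q using A B by (auto simp: a_def split: prod.splits)
    fix p :: "'a \<times> 'a"
    obtain i j where p: "p = (i, j)" by (cases p)
    have "rat_deriv (h p) = (mat_deriv M) $ i $ j" by (simp add: p h_def mat_deriv_def)
    also have "\<dots> = (\<Sum>k\<in>UNIV. A $ i $ k * M $ k $ j) - (\<Sum>l\<in>UNIV. M $ i $ l * B $ l $ j)"
      by (simp add: M matrix_matrix_mult_def)
    also have "(\<Sum>k\<in>UNIV. A $ i $ k * M $ k $ j)
        = (\<Sum>k\<in>UNIV. \<Sum>l\<in>UNIV. (if l = j then A $ i $ k else 0) * M $ k $ l)"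
      by (simp add: if_distrib[of "\<lambda>c. c * _"] cong: if_cong)
    also have "(\<Sum>l\<in>UNIV. M $ i $ l * B $ l $ j)
        = (\<Sum>l\<in>UNIV. \<Sum>k\<in>UNIV. (if k = i then B $ l $ j else 0) * M $ k $ l)"
      by (simp add: if_distrib[of "\<lambda>c. c * _"] cong: if_cong) (simp add: mult.commute)
    also have "\<dots> = (\<Sum>k\<in>UNIV. \<Sum>l\<in>UNIV. (if k = i then B $ l $ j else 0) * M $ k $ l)"
      by (rule sum.swap)
    also have "(\<Sum>k\<in>UNIV. \<Sum>l\<in>UNIV. (if l = j then A $ i $ k else 0) * M $ k $ l) - \<dots>
        = (\<Sum>(k, l)\<in>UNIV. a p (k, l) * h (k, l))"
      unfolding UNIV_Times_UNIV[symmetric] sum.cartesian_product[symmetric]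
      by (simp add: p a_def h_def left_diff_distrib sum_subtractf)
    finally show "rat_deriv (h p) = (\<Sum>q\<in>UNIV. a p q * h q)" by simp
  qed
  then show ?thesis by (auto simp: h_def)
qed

section \<open>Solution matrices and the time-1-operator\<close>

lemma has_field_derivative_mat_eval:
  assumes "mat_regular_at x A"
  shows "((\<lambda>s. mat_eval A s $ i $ j) has_field_derivative mat_eval (mat_deriv A) x $ i $ j) (at x)"
  using has_field_derivative_rat_eval assms by (simp add: mat_eval_def mat_deriv_def)

lemma has_field_derivative_matrix_mult:
  fixes Y Z :: "complex \<Rightarrow> complex^'n^'n"
  assumes "\<And>i j. ((\<lambda>s. Z s $ i $ j) has_field_derivative dZ $ i $ j) (at t)"
    and "\<And>i j. ((\<lambda>s. Y s $ i $ j) has_field_derivative dY $ i $ j) (at t)"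
  shows "((\<lambda>s. (Z s ** Y s) $ i $ j) has_field_derivative (dZ ** Y t + Z t ** dY) $ i $ j) (at t)"
  unfolding matrix_matrix_mult_def
  using assms by (auto intro!: derivative_eq_intros simp: sum.distrib algebra_simps)

text \<open>For \<open>Z\<close> solving the adjoint equation, \<open>Z Y\<close> is constant along the segment for every solution \<open>Y\<close>.\<close>

lemma time1_eqI:
  fixes A :: "ratfun^'n^'n" and V Z :: "complex \<Rightarrow> complex^'n^'n"
  assumes sub: "closed_segment x (x + 1) \<inter> mat_sing A = {}"
    and U: "open U" "closed_segment x (x + 1) \<subseteq> U"
    and Z: "\<And>t i j. t \<in> U \<Longrightarrow> ((\<lambda>s. Z s $ i $ j) has_field_derivative (- (Z t ** mat_eval A t)) $ i $ j) (at t)"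
    and V: "\<And>t i j. t \<in> U \<Longrightarrow> ((\<lambda>s. V s $ i $ j) has_field_derivative (mat_eval A t ** V t) $ i $ j) (at t)"
    and VZ: "V x ** Z x = mat 1" "V (x + 1) ** Z (x + 1) = mat 1"
  shows "time1 A x = V (x + 1) ** Z x"
proof -
  \<comment> \<open>The constant right factor \<open>Z x\<close> normalises the solution to the
    identity at \<open>x\<close>.\<close>
  define Y where "Y t = V t ** Z x" for t
  \<comment> \<open>\<open>U\<close> may contain singularities off the segment, whereas
    \<open>continued_solution\<close> asks for a neighbourhood free of them.\<close>
  define W where "W = U - mat_sing A"
  have W: "open W" "closed_segment x (x + 1) \<subseteq> W"
    using U sub finite_imp_closed[OF finite_mat_sing] by (auto simp: W_def open_Diff)
  have dY: "((\<lambda>s. Y s $ i $ j) has_field_derivative (mat_eval A t ** Y t) $ i $ j) (at t)" if "t \<in> U" for t i j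
    using has_field_derivative_matrix_mult[of V _ t "\<lambda>_. Z x" 0 i j] V[OF that]
    by (simp add: Y_def matrix_mul_assoc)
  have Y: "continued_solution A x Y"
    unfolding continued_solution_def solves_on_def
    using VZ W dY by (auto simp: Y_def W_def intro!: exI[of _ W])
  show ?thesis unfolding time1_def
  proof (rule the_equality)
    show "\<exists>Y. continued_solution A x Y \<and> V (x + 1) ** Z x = Y (x + 1)"
      using Y by (auto simp: Y_def intro!: exI[of _ Y])
    fix M assume "\<exists>Y. continued_solution A x Y \<and> M = Y (x + 1)"
    then obtain Y' U' where Y': "Y' x = mat 1" "M = Y' (x + 1)" "open U'"
      "closed_segment x (x + 1) \<subseteq> U'" "solves_on A U' Y'"
      unfolding continued_solution_def by blast
    have "(Z (x + 1) ** Y' (x + 1)) $ i $ j = (Z x ** Y' x) $ i $ j" for i j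
    proof -
      have "((\<lambda>s. (Z s ** Y' s) $ i $ j) has_field_derivative 0) (at t within closed_segment x (x + 1))"
        if "t \<in> closed_segment x (x + 1)" for t
      proof -
        have "t \<in> U" "t \<in> U'" using that U Y' by auto
        then have "((\<lambda>s. (Z s ** Y' s) $ i $ j) has_field_derivative
           (- (Z t ** mat_eval A t) ** Y' t + Z t ** (mat_eval A t ** Y' t)) $ i $ j) (at t)"
          using Y'(5) Z by (intro has_field_derivative_matrix_mult) (auto simp: solves_on_def)
        then show ?thesis
          by (simp add: matrix_ring_simps has_field_derivative_at_within)
      qed
      then have "\<exists>c. \<forall>t\<in>closed_segment x (x + 1). (Z t ** Y' t) $ i $ j = c"
        by (intro has_field_derivative_zero_constant convex_closed_segment)
      then show ?thesis by auto
    qed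
    then have "Z (x + 1) ** Y' (x + 1) = Z x" using Y'(1) by (simp add: vec_eq_iff)
    then have "V (x + 1) ** Z x = (V (x + 1) ** Z (x + 1)) ** Y' (x + 1)"
      by (simp flip: matrix_mul_assoc)
    then show "M = V (x + 1) ** Z x" using VZ Y' by simp
  qed
qed

section \<open>From a constant diagonal form to a rational time-1-operator\<close>

lemma time1_domain_segment:
  assumes "x \<in> time1_domain A" shows "closed_segment x (x + 1) \<inter> mat_sing A = {}"
proof (rule ccontr)
  assume "\<not> ?thesis"
  then obtain t where t: "t \<in> mat_sing A" "t \<in> closed_segment x (x + 1)" by blast
  then obtain u where u: "0 \<le> u" "u \<le> 1" "t = x + of_real u"
    by (auto simp: closed_segment_def scaleR_conv_of_real algebra_simps)
  \<comment> \<open>This convex combination equals \<open>t - u\<close>.\<close>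
  have "x = (1 - (1 - u) / 2) *\<^sub>R (t - 1) + ((1 - u) / 2) *\<^sub>R (t + 1)"
    using u(3) by (simp add: scaleR_conv_of_real field_simps)
  moreover have "0 \<le> (1 - u) / 2" "(1 - u) / 2 \<le> 1" using u by auto
  ultimately have "x \<in> closed_segment (t - 1) (t + 1)" unfolding closed_segment_def by blast
  then show False using assms t(1) by (auto simp: time1_domain_def)
qed

text \<open>With \<open>H\<close> inverse to \<open>G\<close>, \<open>V(t) = H(t) exp(B t)\<close>
  is a fundamental matrix with inverse \<open>Z(t) = exp(- B t) G(t)\<close>. In
  \<open>V(x + 1) Z(x)\<close> the exponentials combine to the constant \<open>exp B\<close>, so
  only rational entries remain.\<close>

lemma time1_rational_if_constant_diagonal:
  assumes "gauge_equiv A B" "constant_diagonal B" shows "time1_rational A"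
proof -
  obtain G where G: "invertible G" "B = mat_deriv G ** matrix_inv G + G ** A ** matrix_inv G"
    using assms(1) by (auto simp: gauge_equiv_def)
  define H where "H = matrix_inv G"
  have GH: "G ** H = mat 1" "H ** G = mat 1"
    using G(1) by (simp_all add: H_def matrix_inv_left matrix_inv_right)
  have "B ** G = mat_deriv G ** (H ** G) + G ** A ** (H ** G)"
    unfolding G(2) H_def[symmetric] by (simp add: matrix_ring_simps)
  then have dG: "mat_deriv G = B ** G - G ** A" by (simp add: GH)
  then have dH: "mat_deriv H = A ** H - H ** B" using GH by (rule mat_deriv_inverse[rotated 2])
  obtain c where "\<And>i. B $ i $ i = Fract [:c i:] 1"
    using assms(2) unfolding constant_diagonal_def by metis
  then have B: "B $ i $ j = (if i = j then to_fract [:c i:] else 0)" for i j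
    using assms(2) by (simp add: constant_diagonal_def to_fract_Fract)
  have regB: "mat_regular_at x B" for x by (simp add: B)
  have evB: "mat_eval B x = (\<chi> i j. if i = j then c i else 0)" for x
    by (simp add: mat_eval_def B vec_eq_iff)
  \<comment> \<open>\<open>B\<close> has no poles, so \<open>G\<close> and \<open>H\<close> can have
    poles only at singularities of \<open>A\<close>.\<close>
  have regG: "mat_regular_at x G" if "mat_regular_at x A" for x
    using mat_regular_at_ordinary_point[OF regB that dG] .
  have regH: "mat_regular_at x H" if "mat_regular_at x A" for x
    using mat_regular_at_ordinary_point[OF that regB dH] .
  define E where "E s = (\<chi> i j. if i = j then exp (c i * s) else 0)" for s :: complex
  \<comment> \<open>\<open>exp B\<close> as a matrix of constant rational functions.\<close>
  define E1 where "E1 = (\<chi> i j. if i = j then to_fract [:exp (c i):] else 0)"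
  have EE: "E s ** E t = E (s + t)" for s t
    by (simp add: E_def matrix_matrix_mult_def vec_eq_iff exp_add[symmetric] algebra_simps
        if_distrib[of "\<lambda>c. c * _"] cong: if_cong)
  have E0: "E 0 = mat 1" by (simp add: E_def mat_def vec_eq_iff)
  have dE: "((\<lambda>s. E s $ i $ j) has_field_derivative (E t ** mat_eval B t) $ i $ j) (at t)" for t i j
    by (cases "i = j") (auto simp: E_def evB matrix_matrix_mult_def if_distrib[of "\<lambda>c. c * _"]
        mult.commute cong: if_cong intro!: derivative_eq_intros)
  have EB: "E t ** mat_eval B t = mat_eval B t ** E t" for t
    by (simp add: E_def evB matrix_matrix_mult_def vec_eq_iff if_distrib[of "\<lambda>c. c * _"]
        if_distrib[of "\<lambda>c. _ * c"] mult.commute cong: if_cong)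
  have dE': "((\<lambda>s. E (- s) $ i $ j) has_field_derivative (- (E (- t) ** mat_eval B t)) $ i $ j) (at t)" for t i j
    by (cases "i = j") (auto simp: E_def evB matrix_matrix_mult_def if_distrib[of "\<lambda>c. c * _"]
        mult.commute cong: if_cong intro!: derivative_eq_intros)
  define R where "R = mat_shift 1 H ** E1 ** G"
  have "x \<notin> mat_sing R \<and> time1 A x = mat_eval R x" if x: "x \<in> time1_domain A" for x
  proof
    have seg: "closed_segment x (x + 1) \<inter> mat_sing A = {}" using x by (rule time1_domain_segment)
    have reg: "mat_regular_at x A" "mat_regular_at (x + 1) A"
      using seg mat_sing_iff[of x A] mat_sing_iff[of "x + 1" A] by auto
    have regE1: "mat_regular_at x E1" by (simp add: E1_def)
    note R1 = mat_regular_at_mult[OF mat_regular_at_mult[OF mat_regular_at_shift[OF regH[OF reg(2)]] regE1] regG[OF reg(1)]]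
    then show "x \<notin> mat_sing R" unfolding mat_sing_iff R_def by simp
    have evR: "mat_eval R x = mat_eval H (x + 1) ** E 1 ** mat_eval G x"
    proof -
      have "mat_eval E1 x = E 1" by (auto simp: E1_def E_def mat_eval_def vec_eq_iff)
      then show ?thesis
        unfolding R_def using regH[OF reg(2)] regG[OF reg(1)] regE1
        by (simp add: mat_eval_mult mat_regular_at_mult mat_regular_at_shift mat_eval_shift)
    qed
    define U where "U = UNIV - mat_sing A"
    have U: "open U" "closed_segment x (x + 1) \<subseteq> U"
      using seg finite_imp_closed[OF finite_mat_sing] by (auto simp: U_def open_Diff)
    have Ureg: "mat_regular_at t A" if "t \<in> U" for t using that by (simp add: U_def mat_sing_iff)
    have evGH: "mat_eval H t ** mat_eval G t = mat 1" if "t \<in> U" for t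
      using mat_eval_mult[OF regH regG, OF Ureg Ureg, OF that that] by (simp add: GH mat_eval_mat1)
    have "time1 A x = (mat_eval H (x + 1) ** E (x + 1)) ** (E (- x) ** mat_eval G x)"
    proof (rule time1_eqI[OF seg U, where Z = "\<lambda>t. E (- t) ** mat_eval G t" and V = "\<lambda>t. mat_eval H t ** E t"])
      fix t i j assume t: "t \<in> U"
      note rG = regG[OF Ureg[OF t]] and rH = regH[OF Ureg[OF t]] and rA = Ureg[OF t]
      have "mat_eval (mat_deriv G) t = mat_eval B t ** mat_eval G t - mat_eval G t ** mat_eval A t"
        unfolding dG by (simp add: mat_eval_diff mat_eval_mult mat_regular_at_mult rG rA regB)
      moreover have "((\<lambda>s. (E (- s) ** mat_eval G s) $ i $ j) has_field_derivative
          (- (E (- t) ** mat_eval B t) ** mat_eval G t + E (- t) ** mat_eval (mat_deriv G) t) $ i $ j) (at t)"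
        by (intro has_field_derivative_matrix_mult dE' has_field_derivative_mat_eval rG)
      ultimately show "((\<lambda>s. (E (- s) ** mat_eval G s) $ i $ j) has_field_derivative
          (- (E (- t) ** mat_eval G t ** mat_eval A t)) $ i $ j) (at t)"
        by (simp add: matrix_ring_simps)
      have "mat_eval (mat_deriv H) t = mat_eval A t ** mat_eval H t - mat_eval H t ** mat_eval B t"
        unfolding dH by (simp add: mat_eval_diff mat_eval_mult mat_regular_at_mult rH rA regB)
      moreover have "((\<lambda>s. (mat_eval H s ** E s) $ i $ j) has_field_derivative
          (mat_eval (mat_deriv H) t ** E t + mat_eval H t ** (E t ** mat_eval B t)) $ i $ j) (at t)"
        by (intro has_field_derivative_matrix_mult dE has_field_derivative_mat_eval rH)
      ultimately show "((\<lambda>s. (mat_eval H s ** E s) $ i $ j) has_field_derivative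
          (mat_eval A t ** (mat_eval H t ** E t)) $ i $ j) (at t)"
        by (simp add: EB) (simp add: matrix_ring_simps)
    next
      have VZ: "(mat_eval H t ** E t) ** (E (- t) ** mat_eval G t) = mat 1" if "t \<in> U" for t
      proof -
        have "(mat_eval H t ** E t) ** (E (- t) ** mat_eval G t)
            = mat_eval H t ** (E t ** E (- t)) ** mat_eval G t" by (simp add: matrix_mul_assoc)
        then show ?thesis by (simp add: EE E0 evGH that)
      qed
      have "x \<in> U" "x + 1 \<in> U" using U(2) by auto
      then show "mat_eval H x ** E x ** (E (- x) ** mat_eval G x) = mat 1"
        "mat_eval H (x + 1) ** E (x + 1) ** (E (- (x + 1)) ** mat_eval G (x + 1)) = mat 1"
        by (simp_all only: VZ)
    qed
    also have "\<dots> = mat_eval H (x + 1) ** (E (x + 1) ** E (- x)) ** mat_eval G x"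
      by (simp add: matrix_mul_assoc)
    finally show "time1 A x = mat_eval R x" by (simp add: EE evR)
  qed
  then show ?thesis unfolding time1_rational_def by blast
qed

section \<open>The difference equation of the time-1-operator\<close>

text \<open>Serves to deduce invertibility over the rational functions from a single invertible
  value.\<close>

lemma rat_eval_det:
  assumes "mat_regular_at x M"
  shows "rat_eval (det M) x = det (mat_eval M x)"
proof -
  have sign: "regular_at x (of_int (sign p))" "rat_eval (of_int (sign p)) x = of_int (sign p)" for p :: "'a \<Rightarrow> 'a"
  proof -
    have "regular_at x (-1)" "rat_eval (-1) x = -1"
      using regular_at_minus[of x 1] rat_eval_minus[of x 1] by simp_all
    then show "regular_at x (of_int (sign p))" "rat_eval (of_int (sign p)) x = of_int (sign p)"
      by (cases rule: sign_cases[of p]; simp)+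
  qed
  have prod: "regular_at x (\<Prod>i\<in>UNIV. M $ i $ p i)" for p using assms by auto
  show "rat_eval (det M) x = det (mat_eval M x)"
    unfolding det_def using assms
    by (subst rat_eval_sum)
      (auto simp: rat_eval_mult sign prod rat_eval_prod mat_eval_def intro!: regular_at_mult)
qed

text \<open>The columns of \<open>V\<close> solve the system and the rows of \<open>Z\<close> its
  adjoint, with unit initial vectors; then \<open>Z V\<close> has derivative 0 and is the identity
  at the centre. Regularity on the closed ball supplies the bound for the Picard iteration by
  compactness.\<close>

lemma fundamental_solution_on_ball:
  fixes A :: "ratfun^'n^'n"
  assumes reg: "\<And>t. t \<in> cball x0 r \<Longrightarrow> mat_regular_at t A" and r: "0 < r"
  shows "\<exists>V Z :: complex \<Rightarrow> complex^'n^'n. \<forall>t\<in>ball x0 r.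
    (\<forall>i j. ((\<lambda>s. V s $ i $ j) has_field_derivative (mat_eval A t ** V t) $ i $ j) (at t)) \<and>
    (\<forall>i j. ((\<lambda>s. Z s $ i $ j) has_field_derivative (- (Z t ** mat_eval A t)) $ i $ j) (at t)) \<and>
    V t ** Z t = mat 1"
proof -
  define a where "a i j z = mat_eval A z $ i $ j" for i j z
  have hol: "a i j holomorphic_on ball x0 r" for i j
  proof -
    have "(a i j has_field_derivative mat_eval (mat_deriv A) z $ i $ j) (at z)" if "z \<in> ball x0 r" for z
      using has_field_derivative_mat_eval[of z A i j] reg[of z] that by (simp add: a_def[abs_def])
    then show ?thesis unfolding holomorphic_on_open[OF open_ball] by blast
  qed
  have "\<exists>M. \<forall>z\<in>cball x0 r. norm (a i j z) \<le> M" for i j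
  proof -
    have "continuous_on (cball x0 r) (a i j)"
    proof (intro continuous_at_imp_continuous_on ballI)
      fix z assume "z \<in> cball x0 r"
      then have "(a i j has_field_derivative mat_eval (mat_deriv A) z $ i $ j) (at z)"
        using has_field_derivative_mat_eval[of z A i j] reg[of z] by (simp add: a_def[abs_def])
      then show "isCont (a i j) z" by (rule DERIV_isCont)
    qed
    then have "bounded (a i j ` cball x0 r)"
      by (intro compact_imp_bounded compact_continuous_image compact_cball)
    then show ?thesis by (auto simp: bounded_iff)
  qed
  then obtain M where M: "\<And>i j z. z \<in> cball x0 r \<Longrightarrow> norm (a i j z) \<le> M i j" by metis
  define K where "K = (\<Sum>i\<in>UNIV. \<Sum>j\<in>UNIV. \<bar>M i j\<bar>)"
  have K: "norm (a i j z) \<le> K" if "z \<in> ball x0 r" for i j z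
  proof -
    have "norm (a i j z) \<le> \<bar>M i j\<bar>" using M[of z i j] that by simp
    also have "\<dots> \<le> (\<Sum>j\<in>UNIV. \<bar>M i j\<bar>)" by (rule member_le_sum) auto
    also have "\<dots> \<le> K" unfolding K_def
      by (rule member_le_sum[where f = "\<lambda>i. \<Sum>j\<in>UNIV. \<bar>M i j\<bar>"]) (auto intro: sum_nonneg)
    finally show ?thesis .
  qed
  have "\<exists>f. (\<forall>i. f i x0 = (if i = k then 1 else 0)) \<and> (\<forall>i. \<forall>z\<in>ball x0 r.
     (f i has_field_derivative (\<Sum>j\<in>UNIV. a i j z * f j z)) (at z))" for k
    by (rule linear_ode_on_ball[OF hol K r])
  then have "\<exists>v. \<forall>k. (\<forall>i. v k i x0 = (if i = k then 1 else 0)) \<and> (\<forall>i. \<forall>z\<in>ball x0 r.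
     (v k i has_field_derivative (\<Sum>j\<in>UNIV. a i j z * v k j z)) (at z))"
    by (intro choice allI)
  then obtain v where v: "\<And>k i. v k i x0 = (if i = k then 1 else 0)"
    "\<And>k i z. z \<in> ball x0 r \<Longrightarrow> (v k i has_field_derivative (\<Sum>j\<in>UNIV. a i j z * v k j z)) (at z)"
    by blast
  have "\<exists>f. (\<forall>i. f i x0 = (if i = k then 1 else 0)) \<and> (\<forall>i. \<forall>z\<in>ball x0 r.
     (f i has_field_derivative (\<Sum>j\<in>UNIV. - a j i z * f j z)) (at z))" for k
    by (rule linear_ode_on_ball[of "\<lambda>i j z. - a j i z" x0 r K])
      (auto simp: K r simp del: mem_ball intro!: holomorphic_intros hol)
  then have "\<exists>w. \<forall>k. (\<forall>i. w k i x0 = (if i = k then 1 else 0)) \<and> (\<forall>i. \<forall>z\<in>ball x0 r.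
     (w k i has_field_derivative (\<Sum>j\<in>UNIV. - a j i z * w k j z)) (at z))"
    by (intro choice allI)
  then obtain w where w: "\<And>k i. w k i x0 = (if i = k then 1 else 0)"
    "\<And>k i z. z \<in> ball x0 r \<Longrightarrow> (w k i has_field_derivative (\<Sum>j\<in>UNIV. - a j i z * w k j z)) (at z)"
    by blast
  define V where "V t = (\<chi> i j. v j i t)" for t
  define Z where "Z t = (\<chi> i j. w i j t)" for t
  have dV: "((\<lambda>s. V s $ i $ j) has_field_derivative (mat_eval A t ** V t) $ i $ j) (at t)"
    if "t \<in> ball x0 r" for t i j
    using v(2)[OF that, of j i] by (simp add: V_def matrix_matrix_mult_def a_def)
  have dZ: "((\<lambda>s. Z s $ i $ j) has_field_derivative (- (Z t ** mat_eval A t)) $ i $ j) (at t)"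
    if "t \<in> ball x0 r" for t i j
    using w(2)[OF that, of i j] by (simp add: Z_def matrix_matrix_mult_def a_def sum_negf mult.commute)
  have ZV: "Z t ** V t = mat 1" if t: "t \<in> ball x0 r" for t
  proof -
    have "(Z t ** V t) $ i $ j = (Z x0 ** V x0) $ i $ j" for i j
    proof -
      have "((\<lambda>s. (Z s ** V s) $ i $ j) has_field_derivative 0) (at t within ball x0 r)"
        if "t \<in> ball x0 r" for t
      proof -
        have "((\<lambda>s. (Z s ** V s) $ i $ j) has_field_derivative
           (- (Z t ** mat_eval A t) ** V t + Z t ** (mat_eval A t ** V t)) $ i $ j) (at t)"
          using that by (intro has_field_derivative_matrix_mult dZ dV)
        then show ?thesis by (simp add: matrix_ring_simps has_field_derivative_at_within)
      qed
      then have "\<exists>c. \<forall>t\<in>ball x0 r. (Z t ** V t) $ i $ j = c"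
        by (intro has_field_derivative_zero_constant convex_ball)
      then show ?thesis using t r by auto
    qed
    moreover have "Z x0 ** V x0 = mat 1"
    proof -
      have "Z x0 = mat 1" "V x0 = mat 1" by (auto simp: V_def Z_def v(1) w(1) mat_def vec_eq_iff)
      then show ?thesis by simp
    qed
    ultimately show ?thesis by (simp add: vec_eq_iff)
  qed
  have VZ: "V t ** Z t = mat 1" if "t \<in> ball x0 r" for t
    using ZV[OF that] by (simp add: matrix_left_right_inverse)
  show ?thesis
    by (intro exI[of _ V] exI[of _ Z] ballI conjI allI dV dZ VZ)
qed

text \<open>On a ball far away from the singularities \<open>T\<^sub>A(x) = V(x + 1) V(x)\<^sup>-\<^sup>1\<close> for a fundamental
  matrix \<open>V\<close>.\<close>

lemma time1_rational_intertwines: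
  fixes A :: "ratfun^'n^'n"
  assumes "time1_rational A"
  obtains R where "invertible R" "mat_deriv R = mat_shift 1 A ** R - R ** A"
proof -
  obtain R :: "ratfun^'n^'n" where R: "\<And>x. x \<in> time1_domain A \<Longrightarrow> x \<notin> mat_sing R \<and> time1 A x = mat_eval R x"
    using assms unfolding time1_rational_def by blast
  have "bounded (mat_sing A)" by (intro finite_imp_bounded finite_mat_sing)
  then obtain c where c: "\<And>a. a \<in> mat_sing A \<Longrightarrow> norm a \<le> c" by (auto simp: bounded_iff)
  then have Rec: "Re a \<le> c" if "a \<in> mat_sing A" for a
    using that complex_Re_le_cmod order_trans by blast
  \<comment> \<open>Singularities have real part at most \<open>c\<close>. Real parts are at least
    \<open>c + 1\<close> on the ball of radius 4, and at least \<open>c + 4\<close> on the ball of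
    radius 1, beyond the excluded segments, whose real parts are at most \<open>c + 1\<close>.
    Adding 1 to a point of the small ball stays in the large one.\<close>
  define x0 where "x0 = complex_of_real (c + 5)"
  have Re_ball: "Re t \<ge> c + 5 - r" if "t \<in> cball x0 r" for t r
  proof -
    have "Re (x0 - t) \<le> r" using that complex_Re_le_cmod[of "x0 - t"] by (simp add: dist_norm)
    then show ?thesis by (simp add: x0_def)
  qed
  have reg: "mat_regular_at t A" if "t \<in> cball x0 4" for t
    using Re_ball[OF that] Rec[of t] mat_sing_iff[of t A] by fastforce
  obtain V Z :: "complex \<Rightarrow> complex^'n^'n" where VZ: "\<And>t i j. t \<in> ball x0 4 \<Longrightarrow>
      ((\<lambda>s. V s $ i $ j) has_field_derivative (mat_eval A t ** V t) $ i $ j) (at t)"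
    "\<And>t i j. t \<in> ball x0 4 \<Longrightarrow>
      ((\<lambda>s. Z s $ i $ j) has_field_derivative (- (Z t ** mat_eval A t)) $ i $ j) (at t)"
    "\<And>t. t \<in> ball x0 4 \<Longrightarrow> V t ** Z t = mat 1"
    using fundamental_solution_on_ball[of x0 4 A, OF reg zero_less_numeral] by blast
  have ball: "x \<in> ball x0 4" "x + 1 \<in> ball x0 4" if "x \<in> ball x0 1" for x
  proof -
    have "norm (x0 - x) < 1" using that by (simp add: dist_norm)
    moreover have "norm (x0 - (x + 1)) \<le> norm (x0 - x) + norm (-1 :: complex)"
      using norm_triangle_ineq[of "x0 - x" "-1"] by (simp add: algebra_simps)
    ultimately show "x \<in> ball x0 4" "x + 1 \<in> ball x0 4" by (auto simp: dist_norm)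
  qed
  have dom: "x \<in> time1_domain A" if "x \<in> ball x0 1" for x
  proof -
    have "x \<notin> closed_segment (a - 1) (a + 1)" if a: "a \<in> mat_sing A" for a
    proof
      assume "x \<in> closed_segment (a - 1) (a + 1)"
      then obtain u where u: "u \<le> 1" "x = (1 - u) *\<^sub>R (a - 1) + u *\<^sub>R (a + 1)"
        by (auto simp: closed_segment_def)
      have "Re x = Re a - 1 + 2 * u" unfolding u(2) by (simp add: algebra_simps)
      then show False using Rec[OF a] u(1) Re_ball[of x 1] \<open>x \<in> ball x0 1\<close> by simp
    qed
    then show ?thesis by (auto simp: time1_domain_def)
  qed
  have regR: "mat_regular_at x R" if "x \<in> ball x0 1" for x
    using R[OF dom[OF that]] by (simp add: mat_sing_iff)
  have evR: "mat_eval R x = V (x + 1) ** Z x" if x: "x \<in> ball x0 1" for x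
  proof -
    have "closed_segment x (x + 1) \<subseteq> ball x0 4"
      using ball[OF x] by (intro closed_segment_subset convex_ball)
    then have "time1 A x = V (x + 1) ** Z x"
      using VZ ball[OF x] time1_domain_segment[OF dom[OF x]]
      by (intro time1_eqI[of _ _ "ball x0 4"]) auto
    then show ?thesis using R[OF dom[OF x]] by simp
  qed
  \<comment> \<open>Differentiating \<open>V(x + 1) Z(x)\<close>, the left factor contributes
    \<open>A(x + 1)\<close> on the left and the right factor \<open>- A(x)\<close> on the
    right.\<close>
  have "mat_eval (mat_deriv R) x = mat_eval (mat_shift 1 A ** R - R ** A) x"
    if x: "x \<in> ball x0 1" for x
  proof -
    have "mat_eval (mat_deriv R) x $ i $ j
        = (mat_eval A (x + 1) ** V (x + 1) ** Z x + V (x + 1) ** (- (Z x ** mat_eval A x))) $ i $ j" for i j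
    proof (rule DERIV_unique)
      show "((\<lambda>s. mat_eval R s $ i $ j) has_field_derivative mat_eval (mat_deriv R) x $ i $ j) (at x)"
        using regR[OF x] by (rule has_field_derivative_mat_eval)
      have "((\<lambda>s. V (s + 1) $ i $ j) has_field_derivative
          (mat_eval A (x + 1) ** V (x + 1)) $ i $ j) (at x)" for i j
        using VZ(1)[OF ball(2)[OF x], of i j] DERIV_shift[of "\<lambda>s. V s $ i $ j" _ x 1] by simp
      then have "((\<lambda>s. (V (s + 1) ** Z s) $ i $ j) has_field_derivative
        (mat_eval A (x + 1) ** V (x + 1) ** Z x + V (x + 1) ** (- (Z x ** mat_eval A x))) $ i $ j) (at x)"
        by (intro has_field_derivative_matrix_mult VZ(2) ball(1) x)
      then show "((\<lambda>s. mat_eval R s $ i $ j) has_field_derivative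
        (mat_eval A (x + 1) ** V (x + 1) ** Z x + V (x + 1) ** (- (Z x ** mat_eval A x))) $ i $ j) (at x)"
        by (rule has_field_derivative_transform_within_open[OF _ open_ball x]) (simp add: evR)
    qed
    then have "mat_eval (mat_deriv R) x
        = mat_eval A (x + 1) ** mat_eval R x - mat_eval R x ** mat_eval A x"
      by (simp add: vec_eq_iff evR[OF x] matrix_ring_simps)
    also have "\<dots> = mat_eval (mat_shift 1 A ** R - R ** A) x"
    proof -
      have "mat_regular_at x A" "mat_regular_at (x + 1) A" using reg ball[OF x] by auto
      then show ?thesis using regR[OF x]
        by (simp add: mat_eval_diff mat_eval_mult mat_regular_at_mult mat_regular_at_shift mat_eval_shift)
    qed
    finally show ?thesis .
  qed
  moreover have "mat_regular_at x (mat_deriv R)" "mat_regular_at x (mat_shift 1 A ** R - R ** A)"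
    if x: "x \<in> ball x0 1" for x
  proof -
    have "mat_regular_at x A" "mat_regular_at (x + 1) A" using reg ball[OF x] by auto
    with regR[OF x] show "mat_regular_at x (mat_shift 1 A ** R - R ** A)"
      by (intro mat_regular_at_diff mat_regular_at_mult mat_regular_at_shift)
    show "mat_regular_at x (mat_deriv R)" using regR[OF x] by (rule mat_regular_at_deriv)
  qed
  moreover have "infinite (ball x0 1)"
    using uncountable_ball[of 1 x0] countable_finite by auto
  ultimately have "mat_deriv R $ i $ j = (mat_shift 1 A ** R - R ** A) $ i $ j" for i j
    by (intro ratfun_eqI_infinite[of "ball x0 1"]) (auto simp: mat_eval_def vec_eq_iff)
  then have "mat_deriv R = mat_shift 1 A ** R - R ** A" by (simp add: vec_eq_iff)
  \<comment> \<open>One value suffices: \<open>V(x0 + 1) Z(x0)\<close> has the inverse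
    \<open>V(x0) Z(x0 + 1)\<close>, so \<open>det R\<close> is not 0.\<close>
  moreover have "invertible R"
  proof -
    have x0: "x0 \<in> ball x0 1" by simp
    have "Z x0 ** V x0 = mat 1" "V (x0 + 1) ** Z (x0 + 1) = mat 1"
      using VZ(3) ball[OF x0] by (auto simp: matrix_left_right_inverse)
    then have "(V (x0 + 1) ** Z x0) ** (V x0 ** Z (x0 + 1)) = mat 1"
      by (metis matrix_mul_assoc matrix_mul_rid)
    then have "invertible (mat_eval R x0)"
      unfolding evR[OF x0] by (auto simp: invertible_right_inverse)
    then have "rat_eval (det R) x0 \<noteq> 0"
      using rat_eval_det[OF regR[OF x0]] by (simp add: invertible_det_nz)
    then have "det R \<noteq> 0" by auto
    then show ?thesis by (simp add: invertible_det_nz)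
  qed
  ultimately show ?thesis using that by blast
qed

section \<open>Consistent systems of differential and difference equations\<close>

lemma eventually_shift_notin_finite:
  fixes x :: complex
  assumes "finite F" shows "eventually (\<lambda>m. x + of_nat m \<notin> F) sequentially"
proof -
  have "finite ((\<lambda>m::nat. x + of_nat m) -` F)"
    using assms by (intro finite_vimageI) (auto simp: inj_on_def)
  then show ?thesis
    by (simp add: cofinite_eq_sequentially[symmetric] eventually_cofinite vimage_def)
qed

lemma common_denominator:
  assumes "finite I"
  shows "\<exists>b::complex poly. b \<noteq> 0 \<and> (\<forall>i\<in>I. to_fract b * f i \<in> range to_fract)"
  using assms
proof induction
  case empty
  show ?case by (intro exI[of _ 1]) auto
next
  case (insert i I)
  then obtain b where b: "b \<noteq> 0" "\<forall>i\<in>I. to_fract b * f i \<in> range to_fract" by blast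
  obtain p q where pq: "f i = Fract p q" "q \<noteq> 0" by (rule ratfun_cases)
  have "to_fract (b * q) * f i = to_fract (b * p)"
    using pq by (simp add: to_fract_Fract eq_fract)
  then have "to_fract (b * q) * f i \<in> range to_fract" by blast
  moreover have "to_fract (b * q) * f j \<in> range to_fract" if j: "j \<in> I" for j
  proof -
    obtain p' where p': "to_fract b * f j = to_fract p'" using b j by blast
    have "to_fract (b * q) * f j = to_fract q * (to_fract b * f j)" by (simp add: mult_ac)
    also have "\<dots> = to_fract (q * p')" by (simp add: p')
    finally show ?thesis by blast
  qed
  ultimately show ?case using b pq by (intro exI[of _ "b * q"]) (auto simp del: to_fract_mult)
qed

lemma exists_pderiv_eq: "\<exists>r. pderiv r = p" for p :: "complex poly"
proof -
  have "pderiv (\<Sum>i\<le>degree p. monom (coeff p i / of_nat (Suc i)) (Suc i))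
      = (\<Sum>i\<le>degree p. monom (coeff p i) i)"
    using higher_pderiv_sum[of 1 "\<lambda>i. monom (coeff p i / of_nat (Suc i)) (Suc i)" "{..degree p}"]
    by (simp add: pderiv_monom del: of_nat_Suc)
  then show ?thesis using poly_as_sum_of_monoms by metis
qed

text \<open>For nonzero \<open>a\<close>, \<open>p / a\<close> solves the equation up to the error
  \<open>p' / a\<close> of smaller degree, which is corrected recursively; for \<open>a = 0\<close>
  a primitive is taken.\<close>

lemma exists_pderiv_plus_smult_eq: "\<exists>r. pderiv r + smult a r = p" for p :: "complex poly"
proof (cases "a = 0")
  case True
  then show ?thesis using exists_pderiv_eq by simp
next
  case False
  show ?thesis
  proof (induction "degree p" arbitrary: p rule: less_induct)
    case less
    define s where "s = smult (1 / a) p"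
    have s: "smult a s = p" using False by (simp add: s_def)
    show ?case
    proof (cases "degree p = 0")
      case True
      then have "pderiv s = 0" by (simp add: pderiv_eq_0_iff s_def)
      then show ?thesis using s by (intro exI[of _ s]) simp
    next
      case deg: False
      have "degree (pderiv s) < degree p" using deg False by (simp add: degree_pderiv s_def)
      then obtain t where "pderiv t + smult a t = pderiv s" using less by blast
      then show ?thesis using s
        by (intro exI[of _ "s - t"]) (simp add: pderiv_diff smult_diff_right algebra_simps)
    qed
  qed
qed

definition vec_deriv :: "ratfun^'n \<Rightarrow> ratfun^'n" where
  "vec_deriv w = (\<chi> i. rat_deriv (w $ i))"

definition vec_shift :: "complex \<Rightarrow> ratfun^'n \<Rightarrow> ratfun^'n" where
  "vec_shift a w = (\<chi> i. rat_shift a (w $ i))"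

abbreviation vec_regular_at :: "complex \<Rightarrow> ratfun^'n \<Rightarrow> bool" where
  "vec_regular_at x w \<equiv> \<forall>i. regular_at x (w $ i)"

lemma vec_regular_at_mult:
  "mat_regular_at x M \<Longrightarrow> vec_regular_at x w \<Longrightarrow> vec_regular_at x (M *v w)"
  by (auto simp: matrix_vector_mult_def intro!: regular_at_sum regular_at_mult)

lemma vec_deriv_mult: "vec_deriv (M *v w) = mat_deriv M *v w + M *v vec_deriv w"
  by (simp add: vec_deriv_def mat_deriv_def matrix_vector_mult_def vec_eq_iff rat_deriv_sum
      rat_deriv_mult sum.distrib)

lemma vec_shift_mult: "vec_shift a (M *v w) = mat_shift a M *v vec_shift a w"
  by (simp add: vec_shift_def mat_shift_def matrix_vector_mult_def vec_eq_iff rat_shift_sum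
      rat_shift_mult)

lemma vec_deriv_shift: "vec_deriv (vec_shift a w) = vec_shift a (vec_deriv w)"
  by (simp add: vec_deriv_def vec_shift_def rat_deriv_shift)

lemma vec_deriv_add: "vec_deriv (v + w) = vec_deriv v + vec_deriv w"
  by (simp add: vec_deriv_def vec_eq_iff rat_deriv_add)

lemma vec_shift_add: "vec_shift a (v + w) = vec_shift a v + vec_shift a w"
  by (simp add: vec_shift_def vec_eq_iff rat_shift_add)

lemma vec_shift_diff: "vec_shift a (v - w) = vec_shift a v - vec_shift a w"
  by (simp add: vec_shift_def vec_eq_iff rat_shift_diff)

lemma vec_deriv_scale: "vec_deriv (c *s w) = rat_deriv c *s w + c *s vec_deriv w"
  by (simp add: vec_deriv_def vec_eq_iff rat_deriv_mult)

lemma vec_shift_scale: "vec_shift a (c *s w) = rat_shift a c *s vec_shift a w"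
  by (simp add: vec_shift_def vec_eq_iff rat_shift_mult)

text \<open>The equation for \<open>T\<close> is the compatibility of \<open>y' = A y\<close> with
  \<open>y(x + 1) = T(x) y(x)\<close>. From here on the argument is algebraic and refers to no
  analytic solution.\<close>

locale consistent_pair =
  fixes A T :: "ratfun^'n^'n"
  assumes inv: "invertible T" and T: "mat_deriv T = mat_shift 1 A ** T - T ** A"
begin

definition T' :: "ratfun^'n^'n" where "T' = matrix_inv T"

lemma TT': "T ** T' = mat 1" "T' ** T = mat 1"
  using inv by (simp_all add: T'_def matrix_inv_left matrix_inv_right)

lemma deriv_T': "mat_deriv T' = A ** T' - T' ** mat_shift 1 A"
  using mat_deriv_inverse[OF TT' T] .

definition scl :: "complex \<Rightarrow> ratfun^'n \<Rightarrow> ratfun^'n" where "scl c w = to_fract [:c:] *s w"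
definition D :: "ratfun^'n \<Rightarrow> ratfun^'n" where "D w = vec_deriv w - A *v w"
definition X :: "ratfun^'n \<Rightarrow> ratfun^'n" where "X w = to_fract [:0, 1:] *s w"
definition S :: "ratfun^'n \<Rightarrow> ratfun^'n" where "S w = T' *v vec_shift 1 w"

lemma const_fract: "to_fract [:a + b:] = to_fract [:a:] + to_fract [:b:]"
  "to_fract [:a * b:] = to_fract [:a:] * to_fract [:b:]" for a b :: complex
  by (simp_all flip: to_fract_add to_fract_mult)

lemma D_scale: "D (to_fract p *s w) = to_fract (pderiv p) *s w + to_fract p *s D w"
  by (simp add: D_def vec_deriv_scale vector_scalar_commute vector_ssub_ldistrib)

sublocale weyl_action scl D X
proof
  fix a b :: complex and v w :: "ratfun^'n"
  show "scl a (v + w) = scl a v + scl a w" by (simp add: scl_def vector_add_ldistrib)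
  show "scl (a + b) v = scl a v + scl b v" by (simp add: scl_def const_fract vector_sadd_rdistrib)
  show "scl a (scl b v) = scl (a * b) v" by (simp add: scl_def const_fract vector_smult_assoc)
  show "scl 1 v = v" by (simp add: scl_def)
  show "D (v + w) = D v + D w" by (simp add: D_def vec_deriv_add matrix_vector_right_distrib)
  show "D (scl a v) = scl a (D v)" by (simp add: scl_def D_scale)
  show "X (v + w) = X v + X w" by (simp add: X_def vector_add_ldistrib)
  show "X (scl a v) = scl a (X v)" by (simp add: X_def scl_def vector_smult_assoc mult.commute)
  show "D (X v) = X (D v) + v" by (simp add: X_def D_scale pderiv_pCons)
qed

section \<open>Products of shifts of \<open>T\<close> and their poles\<close>

fun Tm :: "nat \<Rightarrow> ratfun^'n^'n" where
  "Tm 0 = mat 1"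
| "Tm (Suc m) = mat_shift 1 (Tm m) ** T"

fun Tm' :: "nat \<Rightarrow> ratfun^'n^'n" where
  "Tm' 0 = mat 1"
| "Tm' (Suc m) = T' ** mat_shift 1 (Tm' m)"

text \<open>The defining recursion adds the rightmost factor \<open>T(x)\<close>; this form adds the
  leftmost factor \<open>T(x + m)\<close>, which is regular at a given point for large
  \<open>m\<close>.\<close>

lemma Tm_Suc: "Tm (Suc m) = mat_shift (of_nat m) T ** Tm m"
proof (induction m)
  case (Suc m)
  have "Tm (Suc (Suc m)) = mat_shift 1 (mat_shift (of_nat m) T ** Tm m) ** T"
    by (simp only: Tm.simps(2)[of "Suc m"] Suc)
  also have "\<dots> = mat_shift (of_nat (Suc m)) T ** Tm (Suc m)"
    by (simp add: mat_shift_mult mat_shift_shift matrix_mul_assoc)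
  finally show ?case .
qed (simp add: mat_shift_mat1)

lemma Tm'_Suc: "Tm' (Suc m) = Tm' m ** mat_shift (of_nat m) T'"
proof (induction m)
  case (Suc m)
  have "Tm' (Suc (Suc m)) = T' ** mat_shift 1 (Tm' m ** mat_shift (of_nat m) T')"
    by (simp only: Tm'.simps(2)[of "Suc m"] Suc)
  also have "\<dots> = Tm' (Suc m) ** mat_shift (of_nat (Suc m)) T'"
    by (simp add: mat_shift_mult mat_shift_shift matrix_mul_assoc)
  finally show ?case .
qed (simp add: mat_shift_mat1)

lemma Tm_Tm': "Tm m ** Tm' m = mat 1"
proof (induction m)
  case (Suc m)
  have "Tm (Suc m) ** Tm' (Suc m) = mat_shift 1 (Tm m) ** (T ** T') ** mat_shift 1 (Tm' m)"
    by (simp add: matrix_mul_assoc)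
  also have "\<dots> = mat_shift 1 (Tm m ** Tm' m)" by (simp add: TT' mat_shift_mult)
  finally show ?case by (simp add: Suc mat_shift_mat1)
qed simp

lemma Tm'_Tm: "Tm' m ** Tm m = mat 1"
  using Tm_Tm' by (simp add: matrix_left_right_inverse)

text \<open>Composing the gauge transformations \<open>T(x + i)\<close> from \<open>A(x + i)\<close>
  to \<open>A(x + i + 1)\<close> carries \<open>A\<close> to \<open>A(x + m)\<close>, whose
  singularities move away from any given point as \<open>m\<close> grows.\<close>

lemma deriv_Tm: "mat_deriv (Tm m) = mat_shift (of_nat m) A ** Tm m - Tm m ** A"
proof (induction m)
  case 0
  show ?case by (simp add: mat_deriv_mat1)
next
  case (Suc m)
  have "mat_deriv (Tm (Suc m)) = mat_shift 1 (mat_deriv (Tm m)) ** T + mat_shift 1 (Tm m) ** mat_deriv T"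
    by (simp add: mat_deriv_mult mat_deriv_shift)
  also have "\<dots> = mat_shift (of_nat (Suc m)) A ** Tm (Suc m) - Tm (Suc m) ** A"
    unfolding Suc T by (simp add: mat_shift_mult mat_shift_diff mat_shift_shift matrix_ring_simps)
  finally show ?case .
qed

lemma deriv_Tm': "mat_deriv (Tm' m) = A ** Tm' m - Tm' m ** mat_shift (of_nat m) A"
  using mat_deriv_inverse[OF Tm_Tm' Tm'_Tm deriv_Tm] .

lemma eventually_regular_shift:
  "eventually (\<lambda>m. mat_regular_at x (mat_shift (of_nat m) M)) sequentially"
  using eventually_shift_notin_finite[OF finite_mat_sing, of x M]
  by eventually_elim (auto simp: mat_sing_iff intro: mat_regular_at_shift[rule_format])

definition pole_bound :: "complex poly \<Rightarrow> complex \<Rightarrow> ratfun^'n^'n \<Rightarrow> bool" where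
  "pole_bound p x M \<longleftrightarrow> (\<forall>i j. regular_at x (to_fract p * M $ i $ j))"

lemma pole_bound_mult_left:
  assumes "mat_regular_at x P" "pole_bound p x M" shows "pole_bound p x (P ** M)"
proof -
  have "to_fract p * (P ** M) $ i $ j = (\<Sum>k\<in>UNIV. P $ i $ k * (to_fract p * M $ k $ j))" for i j
    by (simp add: matrix_matrix_mult_def sum_distrib_left mult_ac)
  then show ?thesis using assms by (auto simp: pole_bound_def intro!: regular_at_sum)
qed

lemma pole_bound_mult_right:
  assumes "mat_regular_at x P" "pole_bound p x M" shows "pole_bound p x (M ** P)"
proof -
  have "to_fract p * (M ** P) $ i $ j = (\<Sum>k\<in>UNIV. (to_fract p * M $ i $ k) * P $ k $ j)" for i j
    by (simp add: matrix_matrix_mult_def sum_distrib_left mult_ac)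
  then show ?thesis using assms by (auto simp: pole_bound_def intro!: regular_at_sum)
qed

lemma pole_bound_mult_poly: "pole_bound p x M \<Longrightarrow> pole_bound (r * p) x M"
  unfolding pole_bound_def to_fract_mult mult.assoc by blast

text \<open>From some index \<open>M\<close> on, the factors \<open>T(x + m)\<close> and their
  inverses are regular at \<open>x\<close>, so an exponent that works for \<open>Tm M\<close> and
  \<open>Tm' M\<close> works for all later products.\<close>

lemma eventually_pole_bound:
  "\<exists>K. eventually (\<lambda>m. pole_bound ([:- x, 1:] ^ K) x (Tm m) \<and> pole_bound ([:- x, 1:] ^ K) x (Tm' m))
     sequentially"
proof -
  have "eventually (\<lambda>m. mat_regular_at x (mat_shift (of_nat m) T) \<and>
      mat_regular_at x (mat_shift (of_nat m) T')) sequentially"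
    by (intro eventually_conj eventually_regular_shift)
  then obtain M where M: "\<forall>m\<ge>M. mat_regular_at x (mat_shift (of_nat m) T) \<and>
      mat_regular_at x (mat_shift (of_nat m) T')"
    unfolding eventually_sequentially by blast
  obtain K where K: "\<forall>p\<in>UNIV. regular_at x (to_fract ([:- x, 1:] ^ K) *
      (case p of (b, i, j) \<Rightarrow> if b then Tm M $ i $ j else Tm' M $ i $ j))"
    using regular_at_times_power_finite[OF finite_class.finite_UNIV] by blast
  have "pole_bound ([:- x, 1:] ^ K) x (Tm m) \<and> pole_bound ([:- x, 1:] ^ K) x (Tm' m)" if "m \<ge> M" for m
    using that
  proof (induction m rule: dec_induct)
    case base
    show ?case using bspec[OF K, of "(True, _, _)"] bspec[OF K, of "(False, _, _)"]
      by (simp add: pole_bound_def)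
  next
    case (step m)
    then show ?case unfolding Tm_Suc Tm'_Suc
      using M by (intro conjI pole_bound_mult_left pole_bound_mult_right) auto
  qed
  then show ?thesis unfolding eventually_sequentially by blast
qed

text \<open>For large \<open>m\<close> both \<open>A\<close> and \<open>A(x + m)\<close> are regular
  at \<open>x\<close>, which is then an ordinary point of the equations for \<open>Tm m\<close> and
  \<open>Tm' m\<close>.\<close>

lemma eventually_regular_Tm:
  assumes "x \<notin> mat_sing A"
  shows "eventually (\<lambda>m. mat_regular_at x (Tm m) \<and> mat_regular_at x (Tm' m)) sequentially"
  using eventually_regular_shift[of x A]
proof eventually_elim
  case (elim m)
  have "mat_regular_at x A" using assms by (simp add: mat_sing_iff)
  with elim show ?case
    using mat_regular_at_ordinary_point[OF _ _ deriv_Tm] mat_regular_at_ordinary_point[OF _ _ deriv_Tm']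
    by blast
qed

text \<open>Only the finitely many singularities of \<open>A\<close> need a factor, so the local
  exponents assemble to one polynomial.\<close>

lemma uniform_pole_bound:
  "\<exists>q. q \<noteq> 0 \<and> (\<forall>x. eventually (\<lambda>m. pole_bound q x (Tm m) \<and> pole_bound q x (Tm' m)) sequentially)"
proof -
  obtain K where K: "\<And>x. eventually (\<lambda>m. pole_bound ([:- x, 1:] ^ K x) x (Tm m) \<and>
      pole_bound ([:- x, 1:] ^ K x) x (Tm' m)) sequentially"
    using eventually_pole_bound by metis
  define q where "q = (\<Prod>x\<in>mat_sing A. [:- x, 1:] ^ K x)"
  have "q \<noteq> 0" by (simp add: q_def finite_mat_sing)
  moreover have "eventually (\<lambda>m. pole_bound q x (Tm m) \<and> pole_bound q x (Tm' m)) sequentially" for x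
  proof (cases "x \<in> mat_sing A")
    case True
    then have q: "q = (\<Prod>x\<in>mat_sing A - {x}. [:- x, 1:] ^ K x) * [:- x, 1:] ^ K x"
      unfolding q_def by (subst prod.remove[OF finite_mat_sing True]) (simp add: mult.commute)
    show ?thesis using K[of x] unfolding q
      by eventually_elim (intro conjI pole_bound_mult_poly, auto)
  next
    case False
    show ?thesis using eventually_regular_Tm[OF False]
      by eventually_elim (auto simp: pole_bound_def)
  qed
  ultimately show ?thesis by blast
qed

section \<open>The module \<open>N\<close> and its stability\<close>

definition N :: "(ratfun^'n) set" where
  "N = {w. \<forall>x. eventually (\<lambda>m. vec_regular_at x (Tm m *v w)) sequentially}"

lemma N_scale: "w \<in> N \<Longrightarrow> to_fract p *s w \<in> N"
  unfolding N_def
proof safe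
  fix x
  assume "\<forall>x. \<forall>\<^sub>F m in sequentially. vec_regular_at x (Tm m *v w)"
  then have "\<forall>\<^sub>F m in sequentially. vec_regular_at x (Tm m *v w)" by blast
  then show "\<forall>\<^sub>F m in sequentially. vec_regular_at x (Tm m *v (to_fract p *s w))"
    by eventually_elim (auto simp: vector_scalar_commute)
qed

lemma N_add: "v \<in> N \<Longrightarrow> w \<in> N \<Longrightarrow> v + w \<in> N"
  unfolding N_def
proof safe
  fix x
  assume "\<forall>x. \<forall>\<^sub>F m in sequentially. vec_regular_at x (Tm m *v v)"
    "\<forall>x. \<forall>\<^sub>F m in sequentially. vec_regular_at x (Tm m *v w)"
  then have "\<forall>\<^sub>F m in sequentially. vec_regular_at x (Tm m *v v)"
    "\<forall>\<^sub>F m in sequentially. vec_regular_at x (Tm m *v w)" by auto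
  then show "\<forall>\<^sub>F m in sequentially. vec_regular_at x (Tm m *v (v + w))"
    by eventually_elim (auto simp: matrix_vector_right_distrib)
qed

text \<open>\<open>Tm m\<close> turns \<open>D\<close> into the connection with matrix
  \<open>A(x + m)\<close>, which is regular at \<open>x\<close> for large \<open>m\<close>.\<close>

lemma N_D: assumes "w \<in> N" shows "D w \<in> N"
  unfolding N_def
proof safe
  fix x
  have "\<forall>\<^sub>F m in sequentially. vec_regular_at x (Tm m *v w)" using assms by (auto simp: N_def)
  then show "\<forall>\<^sub>F m in sequentially. vec_regular_at x (Tm m *v D w)"
    using eventually_regular_shift[of x A]
  proof eventually_elim
    case (elim m)
    have "Tm m *v D w = vec_deriv (Tm m *v w) - mat_shift (of_nat m) A *v (Tm m *v w)"
      by (simp add: D_def vec_deriv_mult deriv_Tm matrix_vector_mult_diff_distrib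
          matrix_vector_mult_diff_rdistrib matrix_vector_mul_assoc)
    moreover have "vec_regular_at x (mat_shift (of_nat m) A *v (Tm m *v w))"
      using elim(2,1) by (rule vec_regular_at_mult)
    moreover have "vec_regular_at x (vec_deriv (Tm m *v w))"
      using elim by (auto simp: vec_deriv_def)
    ultimately show ?case by auto
  qed
qed

lemma Tm_S: "Tm (Suc m) *v S w = vec_shift 1 (Tm m *v w)"
proof -
  have "Tm (Suc m) *v S w = (mat_shift 1 (Tm m) ** (T ** T')) *v vec_shift 1 w"
    by (simp add: S_def matrix_vector_mul_assoc matrix_mul_assoc)
  then show ?thesis by (simp add: TT' vec_shift_mult)
qed

text \<open>By \<open>Tm_S\<close>, regularity for \<open>S w\<close> at \<open>x\<close> and index
  \<open>m + 1\<close> follows from regularity for \<open>w\<close> at \<open>x + 1\<close> and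
  index \<open>m\<close>; the index shift does not affect an eventual property.\<close>

lemma N_S: assumes "w \<in> N" shows "S w \<in> N"
  unfolding N_def
proof safe
  fix x
  have "\<forall>\<^sub>F m in sequentially. vec_regular_at (x + 1) (Tm m *v w)" using assms by (auto simp: N_def)
  then have "\<forall>\<^sub>F m in sequentially. vec_regular_at x (Tm (Suc m) *v S w)"
    unfolding Tm_S by eventually_elim (auto simp: vec_shift_def intro: regular_at_shift)
  then show "\<forall>\<^sub>F m in sequentially. vec_regular_at x (Tm m *v S w)"
    by (subst (asm) eventually_sequentially_Suc)
qed

text \<open>The differential equation of the inverse \<open>T'\<close> is the commutation relation
  in matrix form.\<close>

lemma S_D: "S (D w) = D (S w)"
proof -
  have "D (S w) = mat_deriv T' *v vec_shift 1 w + T' *v vec_shift 1 (vec_deriv w)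
      - A *v (T' *v vec_shift 1 w)"
    by (simp add: D_def S_def vec_deriv_mult vec_deriv_shift)
  also have "\<dots> = T' *v vec_shift 1 (vec_deriv w) - T' *v (mat_shift 1 A *v vec_shift 1 w)"
    by (simp add: deriv_T' matrix_vector_mult_diff_rdistrib matrix_vector_mul_assoc)
  also have "\<dots> = S (D w)"
    by (simp add: S_def D_def vec_shift_diff vec_shift_mult matrix_vector_mult_diff_distrib)
  finally show ?thesis by simp
qed

text \<open>\<open>N_torsion\<close> is applied with the coordinates \<open>q * w $ i\<close>. Since
  \<open>w = Tm' m (Tm m w)\<close> and \<open>q\<close> clears the poles of \<open>Tm' m\<close>,
  these are regular everywhere, hence polynomials.\<close>

theorem N_subset_torsion: "N \<subseteq> torsion"
proof -
  obtain q where q: "q \<noteq> 0"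
    "\<And>x. eventually (\<lambda>m. pole_bound q x (Tm m) \<and> pole_bound q x (Tm' m)) sequentially"
    using uniform_pole_bound by blast
  have poly: "to_fract q * w $ i \<in> range to_fract" if w: "w \<in> N" for w i
  proof (rule polynomial_if_regular)
    fix x
    have "\<forall>\<^sub>F m in sequentially. vec_regular_at x (Tm m *v w)" using w by (simp add: N_def)
    then have "\<forall>\<^sub>F m in sequentially. vec_regular_at x (Tm m *v w) \<and> pole_bound q x (Tm' m)"
      using q(2)[of x] by eventually_elim blast
    from eventually_happens'[OF sequentially_bot this]
    obtain m where m: "vec_regular_at x (Tm m *v w)" "pole_bound q x (Tm' m)" by blast
    have "w = Tm' m *v (Tm m *v w)" by (simp add: matrix_vector_mul_assoc Tm'_Tm)
    then have "to_fract q * w $ i = to_fract q * (Tm' m *v (Tm m *v w)) $ i" by simp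
    also have "\<dots> = (\<Sum>k\<in>UNIV. (to_fract q * Tm' m $ i $ k) * (Tm m *v w) $ k)"
      unfolding matrix_vector_mult_def[of "Tm' m"] by (simp add: sum_distrib_left mult.assoc)
    also have "regular_at x \<dots>"
      using m by (auto simp: pole_bound_def intro!: regular_at_sum)
    finally show "regular_at x (to_fract q * w $ i)" .
  qed
  \<comment> \<open>The polynomial preimage under \<open>to_fract\<close>; it is guaranteed to exist
    for \<open>w\<close> in \<open>N\<close>, the range of the locale's laws for
    \<open>co\<close>.\<close>
  define co where "co w i = (SOME p. to_fract p = to_fract q * w $ i)" for w :: "ratfun^'n" and i
  have co: "to_fract (co w i) = to_fract q * w $ i" if "w \<in> N" for w i
  proof -
    have "\<exists>p. to_fract p = to_fract q * w $ i" using poly[OF that, of i] by (metis imageE)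
    then show ?thesis unfolding co_def by (rule someI_ex)
  qed
  obtain b where b: "b \<noteq> 0" "\<forall>(i, j)\<in>UNIV. to_fract b * A $ i $ j \<in> range to_fract"
    using common_denominator[OF finite_class.finite_UNIV, of "\<lambda>(i, j). A $ i $ j"] by (auto simp: case_prod_unfold)
  then have "\<forall>i j. \<exists>p. to_fract b * A $ i $ j = to_fract p" by auto
  then obtain B where B: "\<And>i j. to_fract b * A $ i $ j = to_fract (B i j)" by metis
  define \<alpha> where "\<alpha> = degree b + degree q + (\<Sum>i\<in>UNIV. \<Sum>j\<in>UNIV. degree (B i j))"
  have degB: "degree (B i j) \<le> (\<Sum>i\<in>UNIV. \<Sum>j\<in>UNIV. degree (B i j))" for i j
  proof -
    have "degree (B i j) \<le> (\<Sum>j\<in>UNIV. degree (B i j))" by (rule member_le_sum) auto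
    also have "\<dots> \<le> (\<Sum>i\<in>UNIV. \<Sum>j\<in>UNIV. degree (B i j))"
      by (rule member_le_sum[where f = "\<lambda>i. \<Sum>j\<in>UNIV. degree (B i j)"]) auto
    finally show ?thesis .
  qed
  have coD: "degree (co (D w) i) \<le> k + \<alpha>" if w: "w \<in> N" and deg: "\<And>i. degree (co w i) \<le> k" for w k i
  proof (cases "co (D w) i = 0")
    case False
    define p where "p = co w"
    have p: "to_fract (p i) = to_fract q * w $ i" for i using co[OF w] by (simp add: p_def)
    have dp: "to_fract (pderiv (p i)) = to_fract (pderiv q) * w $ i + to_fract q * rat_deriv (w $ i)" for i
      using arg_cong[OF p[of i], of rat_deriv] by (simp add: rat_deriv_mult)
    \<comment> \<open>Multiplying \<open>q * D w $ i\<close> by \<open>b\<close> clears the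
      denominators of \<open>A\<close>, and by another \<open>q\<close> replaces \<open>w\<close> by
      \<open>p = q w\<close>; each term then has degree at most \<open>k + \<alpha>\<close>.\<close>
    define R where "R = b * q * pderiv (p i) - b * pderiv q * p i - q * (\<Sum>j\<in>UNIV. B i j * p j)"
    have sum: "to_fract (\<Sum>j\<in>UNIV. B i j * p j) = (\<Sum>j\<in>UNIV. to_fract b * A $ i $ j * (to_fract q * w $ j))"
    proof -
      have "to_fract (\<Sum>j\<in>I. f j) = (\<Sum>j\<in>I. to_fract (f j))" for f :: "'n \<Rightarrow> complex poly" and I
        by (induction I rule: infinite_finite_induct) auto
      then show ?thesis by (simp add: B p)
    qed
    have "to_fract (q * b * co (D w) i) = to_fract q * to_fract b * (to_fract q * D w $ i)"
      by (simp add: co[OF N_D[OF w]])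
    also have "\<dots> = to_fract q * to_fract b * to_fract q * rat_deriv (w $ i)
        - to_fract q * (\<Sum>j\<in>UNIV. to_fract b * A $ i $ j * (to_fract q * w $ j))"
      by (simp add: D_def vec_deriv_def matrix_vector_mult_def right_diff_distrib sum_distrib_left mult_ac)
    also have "\<dots> = to_fract R"
      unfolding R_def to_fract_diff to_fract_mult sum dp p by (simp add: algebra_simps)
    finally have eq: "q * b * co (D w) i = R" by (simp only: to_fract_eq_iff)
    have "degree (B i j * p j) \<le> (\<Sum>i\<in>UNIV. \<Sum>j\<in>UNIV. degree (B i j)) + k" for j
      using degree_mult_le[of "B i j" "p j"] degB[of i j] deg[of j] by (simp add: p_def)
    then have "degree (\<Sum>j\<in>UNIV. B i j * p j) \<le> (\<Sum>i\<in>UNIV. \<Sum>j\<in>UNIV. degree (B i j)) + k"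
      by (intro degree_sum_le) auto
    then have 1: "degree (q * (\<Sum>j\<in>UNIV. B i j * p j)) \<le> k + \<alpha>"
      using degree_mult_le[of q "\<Sum>j\<in>UNIV. B i j * p j"] by (simp add: \<alpha>_def)
    have "degree (b * q * pderiv (p i)) \<le> degree b + degree q + degree (pderiv (p i))"
      using degree_mult_le[of "b * q" "pderiv (p i)"] degree_mult_le[of b q] by linarith
    then have 2: "degree (b * q * pderiv (p i)) \<le> k + \<alpha>"
      using deg[of i] by (simp add: degree_pderiv \<alpha>_def p_def)
    have "degree (b * pderiv q * p i) \<le> degree b + degree (pderiv q) + degree (p i)"
      using degree_mult_le[of "b * pderiv q" "p i"] degree_mult_le[of b "pderiv q"] by linarith
    then have 3: "degree (b * pderiv q * p i) \<le> k + \<alpha>"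
      using deg[of i] by (simp add: degree_pderiv \<alpha>_def p_def)
    have "degree R \<le> k + \<alpha>" unfolding R_def using 1 2 3 by (intro degree_diff_le) auto
    moreover have "degree R = degree q + degree b + degree (co (D w) i)"
      using q b False by (simp flip: eq add: degree_mult_eq)
    ultimately show ?thesis by simp
  qed simp
  have 0: "0 \<in> N" by (auto simp: N_def matrix_vector_mult_def)
  interpret weyl_shift_action scl D X S N co \<alpha>
  proof
    fix v w :: "ratfun^'n" and a :: complex and i k
    show "S (v + w) = S v + S w" by (simp add: S_def vec_shift_add matrix_vector_right_distrib)
    show "S (scl a v) = scl a (S v)"
      by (simp add: S_def scl_def vec_shift_scale vector_scalar_commute pcompose_const)
    show "S (D v) = D (S v)" by (rule S_D)
    show "S (X v) = X (S v) + S v"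
    proof -
      have "to_fract [:1, 1:] = to_fract [:0, 1:] + (1 :: ratfun)"
        using to_fract_add[of "[:0, 1 :: complex:]" "[:1:]"] by simp
      then show ?thesis
        by (simp add: S_def X_def vec_shift_scale vector_scalar_commute pcompose_pCons vector_sadd_rdistrib
            matrix_vector_right_distrib)
    qed
    show "v = 0" if "S v = 0"
    proof -
      have "T *v S v = vec_shift 1 v" by (simp add: S_def matrix_vector_mul_assoc TT')
      then have "vec_shift 1 v = 0" using that by simp
      then show ?thesis by (simp add: vec_shift_def vec_eq_iff)
    qed
    show "subspace N"
      unfolding subspace_def using 0 N_add N_scale by (auto simp: scl_def)
    show "D v \<in> N" if "v \<in> N" using that by (rule N_D)
    show "X v \<in> N" if "v \<in> N" unfolding X_def using that by (rule N_scale)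
    show "S v \<in> N" if "v \<in> N" using that by (rule N_S)
    show "co (v + w) i = co v i + co w i" if "v \<in> N" "w \<in> N"
    proof -
      have "to_fract (co (v + w) i) = to_fract (co v i + co w i)"
        using that by (simp add: co N_add algebra_simps)
      then show ?thesis by (simp only: to_fract_eq_iff)
    qed
    show "co (scl a v) i = smult a (co v i)" if "v \<in> N"
    proof -
      have "to_fract (co (scl a v) i) = to_fract ([:a:] * co v i)"
        unfolding to_fract_mult using that by (simp add: co N_scale scl_def mult_ac)
      then have "co (scl a v) i = [:a:] * co v i" by (simp only: to_fract_eq_iff)
      then show ?thesis by simp
    qed
    show "v = 0" if "v \<in> N" "\<And>i. co v i = 0"
    proof -
      have "to_fract q * v $ i = 0" for i using co[OF that(1), of i] that(2)[of i] by simp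
      then show ?thesis using q(1) by (simp add: vec_eq_iff)
    qed
    show "degree (co (D v) i) \<le> k + \<alpha>" if "v \<in> N" "\<And>i. degree (co v i) \<le> k"
      using that by (rule coD)
  qed
  show ?thesis using N_torsion by blast
qed

text \<open>\<open>Tm m\<close> maps this vector to column \<open>i\<close> of
  \<open>q * Tm m\<close>, which the uniform pole bound makes regular. Hence \<open>N\<close> spans
  the whole space over the rational functions.\<close>

lemma N_contains_multiple_of_axis: "\<exists>q. q \<noteq> 0 \<and> to_fract q *s axis i 1 \<in> N"
proof -
  obtain q where q: "q \<noteq> 0"
    "\<And>x. eventually (\<lambda>m. pole_bound q x (Tm m) \<and> pole_bound q x (Tm' m)) sequentially"
    using uniform_pole_bound by blast
  have ax: "(M *v (c *s axis i 1)) $ j = c * M $ j $ i" for M :: "ratfun^'n^'n" and c j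
    by (simp add: matrix_vector_mult_def axis_def if_distrib[of "\<lambda>c. _ * c"] mult.commute cong: if_cong)
  have "\<forall>\<^sub>F m in sequentially. vec_regular_at x (Tm m *v (to_fract q *s axis i 1))" for x
    using q(2)[of x] unfolding ax by eventually_elim (simp add: pole_bound_def)
  then have "to_fract q *s axis i 1 \<in> N" by (simp add: N_def)
  then show ?thesis using q(1) by blast
qed

section \<open>Eigenvectors of \<open>D\<close> and the diagonal form\<close>

definition eigenvectors :: "(ratfun^'n) set" where
  "eigenvectors = {h. \<exists>c. D h = scl c h}"

text \<open>The \<open>C[x]\<close>-module generated by the eigenvectors, built one multiple at a
  time so that equations for \<open>D\<close> can be solved termwise.\<close>

inductive_set poly_span :: "(ratfun^'n) set" where
  zero: "0 \<in> poly_span"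
| add: "w \<in> poly_span \<Longrightarrow> h \<in> eigenvectors \<Longrightarrow> w + to_fract p *s h \<in> poly_span"

text \<open>If \<open>D h = a h\<close>, then \<open>(D - c) (r h) = (r' + (a - c) r) h\<close>, so
  each term reduces to a first-order equation for a polynomial \<open>r\<close>.\<close>

lemma poly_span_solve: "u \<in> poly_span \<Longrightarrow> \<exists>v\<in>poly_span. D v - scl c v = u"
proof (induction rule: poly_span.induct)
  case zero
  show ?case by (intro bexI[of _ 0] poly_span.zero) simp
next
  case (add w h p)
  then obtain v a where v: "v \<in> poly_span" "D v - scl c v = w" and a: "D h = scl a h"
    by (auto simp: eigenvectors_def)
  obtain r where r: "pderiv r + smult (a - c) r = p" using exists_pderiv_plus_smult_eq by blast
  have p: "to_fract p = to_fract (pderiv r) + to_fract [:a:] * to_fract r - to_fract [:c:] * to_fract r"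
    unfolding r[symmetric] by (simp flip: to_fract_mult to_fract_add to_fract_diff add: smult_diff_left algebra_simps)
  have "D (v + to_fract r *s h) - scl c (v + to_fract r *s h) = w + to_fract p *s h"
    unfolding p v(2)[symmetric] D_add D_scale a scl_def
    by (simp add: vec_eq_iff algebra_simps)
  then show ?case using v(1) add.hyps by (intro bexI[of _ "v + to_fract r *s h"] poly_span.add)
qed

text \<open>Induction on the degree of the annihilator. After splitting off a root \<open>c\<close>,
  \<open>(D - c) w\<close> lies in the span; subtracting a preimage \<open>v\<close> from the span
  leaves the eigenvector \<open>w - v\<close>.\<close>

lemma torsion_subset_poly_span: "torsion \<subseteq> poly_span"
proof -
  have "w \<in> poly_span" if "Q \<noteq> 0" "act Q w = 0" for Q w
    using that
  proof (induction "degree Q" arbitrary: Q w)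
    case 0
    then obtain a where a: "Q = [:a:]" by (metis degree_eq_zeroE)
    then have "scl a w = 0" "a \<noteq> 0" using 0 by auto
    then have "w = 0" by (simp add: scale_eq_0_iff)
    then show ?case by (simp add: poly_span.zero)
  next
    case (Suc n)
    then obtain c where "poly Q c = 0"
      using Fundamental_Theorem_Algebra.fundamental_theorem_of_algebra[of Q] by (metis constant_degree nat.distinct(1))
    then obtain Q1 where Q: "Q = Q1 * [:- c, 1:]" by (metis poly_eq_0_iff_dvd dvd_def mult.commute)
    then have Q1: "Q1 \<noteq> 0" using Suc.prems(1) by auto
    have "Suc n = degree Q1 + degree [:- c, 1:]"
      unfolding Suc.hyps(2) Q using Q1 by (intro degree_mult_eq) auto
    then have deg: "n = degree Q1" by simp
    have "act Q1 (D w - scl c w) = 0"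
      using Suc.prems(2) unfolding Q act_mult by (simp add: algebra_simps)
    then have "D w - scl c w \<in> poly_span" using Suc.hyps(1)[OF deg Q1] by blast
    then obtain v where v: "v \<in> poly_span" "D v - scl c v = D w - scl c w"
      using poly_span_solve by blast
    have "D (w - v) = D w - D v" using D_add[of "w - v" v] by (simp add: algebra_simps)
    also have "\<dots> = scl c w - scl c v" using v(2) by (simp add: algebra_simps)
    finally have "D (w - v) = scl c (w - v)" by (simp add: scale_right_diff_distrib)
    then have "w - v \<in> eigenvectors" by (auto simp: eigenvectors_def)
    from poly_span.add[OF v(1) this, of 1] show ?case by simp
  qed
  then show ?thesis by (auto simp: torsion_def)
qed

text \<open>Polynomial multiples of the unit vectors lie in \<open>N\<close>, hence in
  \<open>poly_span\<close>; over the rational functions the polynomial factor can be divided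
  out.\<close>

lemma span_eigenvectors: "vec.span eigenvectors = UNIV"
proof -
  have "poly_span \<subseteq> vec.span eigenvectors"
  proof
    fix w assume "w \<in> poly_span"
    then show "w \<in> vec.span eigenvectors"
      by induction (auto intro: vec.span_zero vec.span_add vec.span_scale vec.span_base)
  qed
  then have N: "N \<subseteq> vec.span eigenvectors"
    using N_subset_torsion torsion_subset_poly_span by blast
  have axis: "axis i 1 \<in> vec.span eigenvectors" for i
  proof -
    obtain q where q: "q \<noteq> 0" "to_fract q *s axis i 1 \<in> N" using N_contains_multiple_of_axis by blast
    then have "to_fract q *s axis i 1 \<in> vec.span eigenvectors" using N by blast
    then have "inverse (to_fract q) *s (to_fract q *s axis i 1) \<in> vec.span eigenvectors"
      by (rule vec.span_scale)
    then show ?thesis using q(1) by (simp add: vector_smult_assoc)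
  qed
  have "w \<in> vec.span eigenvectors" for w
  proof -
    have "w = (\<Sum>i\<in>UNIV. (w $ i) *s axis i 1)" by (rule basis_expansion[symmetric])
    then show ?thesis using axis by (metis (no_types, lifting) vec.span_sum vec.span_scale)
  qed
  then show ?thesis by blast
qed

text \<open>A basis of eigenvectors, extracted from the spanning set, forms the columns of
  \<open>H\<close>; the gauge transformation is the inverse of \<open>H\<close>.\<close>

theorem equivalent_to_constant_diagonal: "\<exists>B. gauge_equiv A B \<and> constant_diagonal B"
proof -
  obtain E where E: "E \<subseteq> eigenvectors" "vec.independent E" "eigenvectors \<subseteq> vec.span E"
    using vec.maximal_independent_subset by blast
  then have spanE: "vec.span E = UNIV"
    using span_eigenvectors vec.span_minimal[OF E(3) vec.subspace_span] by auto
  have "card E = CARD('n)"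
    using vec.dim_eq_card[of E UNIV] E(2) spanE vec_dim_card by (metis vec.span_UNIV)
  moreover have "finite E" using E(2) by (rule vec.finiteI_independent)
  ultimately obtain f where f: "bij_betw f (UNIV :: 'n set) E"
    using finite_same_card_bij[of "UNIV :: 'n set" E] by auto
  have "f j \<in> eigenvectors" for j using f E(1) by (auto simp: bij_betw_def)
  then have "\<forall>j. \<exists>c. D (f j) = scl c (f j)" by (simp add: eigenvectors_def)
  then obtain c where c: "\<And>j. D (f j) = scl (c j) (f j)" by metis
  define H where "H = (\<chi> i j. f j $ i)"
  have "columns H = E"
    using f by (auto simp: columns_def column_def H_def bij_betw_def)
  then have "\<exists>G. H ** G = mat 1" using spanE by (simp add: matrix_right_invertible_span_columns)
  then obtain G where HG: "H ** G = mat 1" by blast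
  then have GH: "G ** H = mat 1" by (simp add: matrix_left_right_inverse)
  \<comment> \<open>The sign: \<open>D f = c f\<close> reads \<open>f' = A f + c f\<close>, while
    the gauge equation for \<open>H\<close> is \<open>H' = A H - H C\<close>.\<close>
  define C where "C = (\<chi> i j. if i = j then to_fract [:- c i:] else 0)"
  have dH: "mat_deriv H = A ** H - H ** C"
  proof -
    have "rat_deriv (f j $ i) - (A *v f j) $ i = to_fract [:c j:] * f j $ i" for i j
      using c[of j] by (simp add: D_def scl_def vec_deriv_def vec_eq_iff)
    then have "rat_deriv (f j $ i) = (A *v f j) $ i + to_fract [:c j:] * f j $ i" for i j
      by (simp add: algebra_simps)
    moreover have "to_fract [:- c j:] = - to_fract [:c j:]" for j
      by (simp flip: to_fract_uminus)
    ultimately show ?thesis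
      by (simp add: vec_eq_iff mat_deriv_def H_def C_def matrix_matrix_mult_def matrix_vector_mult_def
          if_distrib[of "\<lambda>c. _ * c"] mult.commute cong: if_cong)
  qed
  have dG: "mat_deriv G = C ** G - G ** A" using mat_deriv_inverse[OF HG GH dH] .
  have inv: "invertible G" using GH HG by (auto simp: invertible_def)
  have "matrix_inv G = (matrix_inv G ** G) ** H" by (simp add: GH flip: matrix_mul_assoc)
  then have "matrix_inv G = H" using inv by (simp add: matrix_inv_left)
  then have "mat_deriv G ** matrix_inv G + G ** A ** matrix_inv G = C ** (G ** H)"
    by (simp add: dG matrix_ring_simps)
  then have "C = mat_deriv G ** matrix_inv G + G ** A ** matrix_inv G" by (simp add: GH)
  then have "gauge_equiv A C" using inv by (auto simp: gauge_equiv_def)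
  moreover have "constant_diagonal C" by (auto simp: constant_diagonal_def C_def to_fract_Fract)
  ultimately show ?thesis by blast
qed

end

theorem corollary6:
  fixes A :: "ratfun^'n^'n"
  shows "time1_rational A \<longleftrightarrow> (\<exists>B. gauge_equiv A B \<and> constant_diagonal B)"
proof
  assume "time1_rational A"
  then obtain T where "invertible T" "mat_deriv T = mat_shift 1 A ** T - T ** A"
    by (rule time1_rational_intertwines)
  then interpret consistent_pair A T by unfold_locales
  show "\<exists>B. gauge_equiv A B \<and> constant_diagonal B" by (rule equivalent_to_constant_diagonal)
next
  assume "\<exists>B. gauge_equiv A B \<and> constant_diagonal B"
  then show "time1_rational A" using time1_rational_if_constant_diagonal by blast
qed

end
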